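(* Let $h\ge 2$ be an integer, and let $0<u\le 1/2$. Let $0<x\le 1$ be such that $$\left(\frac{e}{u x}\right)^{2hx} < \left(\frac1u\right)^{h-1}.$$ Suppose $\hat\alpha_u < \min\{(h-1)/2,\; hx\}$. Let $G\sim G_n^h$ or $G\sim\tilde G_n^h$ (two preferential attachment models). Then there exists a constant $c>0$ such that, as $n\to\infty$ (with $h,u,x,\hat\alpha_u$ fixed), $$\mathbb P\big(\alpha_u(G)\ge \hat\alpha_u\big) = 1-o(n^{-c}).$$
   Context: Graphs are finite multigraphs (loops and multiple edges allowed). For a graph $G=(V,E)$ and $S\subseteq V$, $\bar S=V\setminus S$, and $e(S,\bar S)$ is the number of edges (with multiplicity) having one endpoint in $S$ and the other in $\bar S$. For $0<u\le 1/2$ the $u$-bounded edge expansion of $G$ is $$\alpha_u(G)=\min_{S\subseteq V,\ 1\le |S|\le u|V|}\frac{e(S,\bar S)}{|S|},$$ with $\alpha_u(G)=\infty$ if $u|V|<1$. In the claim, $e$ in $(e/ux)$ is Euler's number. Model $G_n^h$ ($h,n\in\mathbb N$). $T_1$ is a single mini-vertex $1$ with a loop $e_1$ (so it has degree $2$). For $t\ge1$, $T_{t+1}$ is obtained from $T_t$ by adding a mini-vertex $t+1$ and an edge $e_{t+1}$ joining $t+1$ to a random mini-vertex $i$, where, conditionally on $T_t$, $\mathbb P(i=s)=\deg_{T_t}(s)/(2t+1)$ for $1\le s\le t$ and $\mathbb P(i=t+1)=1/(2t+1)$ (in which case $e_{t+1}$ is a loop). Loops count $2$ towards the degree. $G_n^h$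 is the random multigraph on $\{1,\dots,n\}$ obtained from $T_{hn}$ by merging, for each $i\in\{1,\dots,n\}$, the mini-vertices $h(i-1)+1,\dots,h(i-1)+h$ into a single vertex $i$, keeping loops and multiple edges. Model $\tilde G_n^h$. $\tilde T_1$ is a single mini-vertex $1$ with a loop $e_1$, where this loop contributes only $1$ to the degree of mini-vertex $1$. For $t\ge 1$, $\tilde T_{t+1}$ is obtained from $\tilde T_t$ by adding a mini-vertex $t+1$ and an edge $e_{t+1}$ joining it to a random mini-vertex $i\in\{1,\dots,t\}$ with, conditionally on $\tilde T_t$, $\mathbb P(i=s)=\deg_{\tilde T_t}(s)/(2t-1)$ for $1\le s\le t$. $\tilde G_n^h$ is obtained from $\tilde T_{hn}$ by the same merging of consecutive blocks of $h$ mini-vertices. The loop $e_1$ contributes $1$ to the degree of its vertex; every other loop contributes $2$. *)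

theory Defs
  imports
    "HOL-Probability.Probability"
    "HOL-Library.Uprod"
    "HOL-Library.Landau_Symbols"
begin

text \<open>
  The edges of a multigraph are listed in order $e_1, e_2, \dots$; a loop at \<open>v\<close> is
  \<open>Upair v v\<close>. The order matters only for singling out the loop $e_1$ in the second model.
\<close>

datatype 'v multigraph = Multigraph (verts: "'v set") (edges: "'v uprod list")

definition cut_size :: "'v multigraph \<Rightarrow> 'v set \<Rightarrow> nat" where
  "cut_size G S =
     length (filter (\<lambda>e. \<exists>x\<in>S. \<exists>y\<in>verts G - S. e = Upair x y) (edges G))"

definition edge_expansion :: "real \<Rightarrow> 'v multigraph \<Rightarrow> ereal" where
  "edge_expansion u G =
     (if u * real (card (verts G)) < 1 then \<infinity>
      else (MIN S\<in>{S. S \<subseteq> verts G \<and> 1 \<le> card S \<and> real (card S) \<le> u * real (card (verts G))}.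
              ereal (real (cut_size G S) / real (card S))))"

definition edge_degree :: "'v uprod \<Rightarrow> 'v \<Rightarrow> nat" where
  "edge_degree e v = (if e = Upair v v then 2 else if v \<in> set_uprod e then 1 else 0)"

definition degree :: "'v multigraph \<Rightarrow> 'v \<Rightarrow> nat" where
  "degree G v = (\<Sum>e\<leftarrow>edges G. edge_degree e v)"

text \<open>The variant of the degree in which $e_1$ contributes only 1 even if it is a loop.\<close>

definition degree' :: "'v multigraph \<Rightarrow> 'v \<Rightarrow> nat" where
  "degree' G v =
     (case edges G of
        [] \<Rightarrow> 0
      | e # es \<Rightarrow> (if v \<in> set_uprod e then 1 else 0) + (\<Sum>e\<leftarrow>es. edge_degree e v))"

definition initial_loop :: "nat multigraph" where
  "initial_loop = Multigraph {1} [Upair 1 1]"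

definition add_mini_vertex :: "nat \<Rightarrow> nat multigraph \<Rightarrow> nat \<Rightarrow> nat multigraph" where
  "add_mini_vertex t T i = Multigraph (insert (t + 1) (verts T)) (edges T @ [Upair (t + 1) i])"

text \<open>
  The conditional law of the endpoint \<open>i\<close> of the edge $e_{t+1}$, given that the current graph
  on \<open>t\<close> mini-vertices is \<open>T\<close>. That the weights sum to 1 for every reachable \<open>T\<close>, so that
  these really are probability mass functions with the displayed weights, is shown in
  \<open>pmf_endpoint_mini_tree\<close> and \<open>pmf_endpoint'_mini_tree'\<close> below.
\<close>

definition endpoint :: "nat \<Rightarrow> nat multigraph \<Rightarrow> nat pmf" where
  "endpoint t T = embed_pmf (\<lambda>s.
     if s \<in> {1..t} then real (degree T s) / (2 * real t + 1)
     else if s = t + 1 then 1 / (2 * real t + 1)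
     else 0)"

definition endpoint' :: "nat \<Rightarrow> nat multigraph \<Rightarrow> nat pmf" where
  "endpoint' t T = embed_pmf (\<lambda>s.
     if s \<in> {1..t} then real (degree' T s) / (2 * real t - 1) else 0)"

text \<open>The processes start at $t = 1$; the value at $t = 0$ is a dummy.\<close>

fun mini_tree :: "nat \<Rightarrow> nat multigraph pmf" where
  "mini_tree 0 = return_pmf (Multigraph {} [])"
| "mini_tree (Suc 0) = return_pmf initial_loop"
| "mini_tree (Suc (Suc t)) =
     bind_pmf (mini_tree (Suc t))
       (\<lambda>T. map_pmf (add_mini_vertex (Suc t) T) (endpoint (Suc t) T))"

fun mini_tree' :: "nat \<Rightarrow> nat multigraph pmf" where
  "mini_tree' 0 = return_pmf (Multigraph {} [])"
| "mini_tree' (Suc 0) = return_pmf initial_loop"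
| "mini_tree' (Suc (Suc t)) =
     bind_pmf (mini_tree' (Suc t))
       (\<lambda>T. map_pmf (add_mini_vertex (Suc t) T) (endpoint' (Suc t) T))"

text \<open>Among the positive \<open>j\<close>, those with \<open>block h j = i\<close> are $h(i-1)+1, \dots, h(i-1)+h$.\<close>

definition block :: "nat \<Rightarrow> nat \<Rightarrow> nat" where
  "block h j = (j - 1) div h + 1"

definition merge_blocks :: "nat \<Rightarrow> nat multigraph \<Rightarrow> nat multigraph" where
  "merge_blocks h T = Multigraph (block h ` verts T) (map (map_uprod (block h)) (edges T))"

definition pa_graph :: "nat \<Rightarrow> nat \<Rightarrow> nat multigraph pmf" where
  "pa_graph h n = map_pmf (merge_blocks h) (mini_tree (h * n))"

definition pa_graph' :: "nat \<Rightarrow> nat \<Rightarrow> nat multigraph pmf" where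
  "pa_graph' h n = map_pmf (merge_blocks h) (mini_tree' (h * n))"


subsection \<open>Well-definedness of the transition laws\<close>

lemma sum_edge_degree:
  assumes "finite A" "set_uprod e \<subseteq> A"
  shows "(\<Sum>v\<in>A. edge_degree e v) = 2"
proof (cases e)
  case (Upair a b)
  have ab: "a \<in> A" "b \<in> A" using assms Upair by auto
  show ?thesis
  proof (cases "a = b")
    case True
    have "edge_degree e v = (if v = a then 2 else 0)" for v
      using Upair True by (auto simp: edge_degree_def)
    then show ?thesis using ab assms(1) by simp
  next
    case False
    have "edge_degree e v = (if v = a then 1 else 0) + (if v = b then 1 else 0)" for v
      using Upair False by (auto simp: edge_degree_def)
    then show ?thesis using ab assms(1) by (simp add: sum.distrib)
  qed
qed

lemma sum_edge_degree_list:
  assumes "finite A" "\<forall>e\<in>set es. set_uprod e \<subseteq> A"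
  shows "(\<Sum>v\<in>A. \<Sum>e\<leftarrow>es. edge_degree e v) = 2 * length es"
  using assms(2) by (induction es) (auto simp: sum.distrib sum_edge_degree assms(1))

definition mini_graph :: "nat \<Rightarrow> nat multigraph \<Rightarrow> bool" where
  "mini_graph t T \<longleftrightarrow> verts T = {1..t} \<and> length (edges T) = t \<and> hd (edges T) = Upair 1 1 \<and>
     (\<forall>e\<in>set (edges T). set_uprod e \<subseteq> {1..t})"

lemma mini_graph_initial_loop: "mini_graph (Suc 0) initial_loop"
  by (auto simp: mini_graph_def initial_loop_def)

lemma mini_graph_add_mini_vertex:
  assumes "mini_graph (Suc t) T" "i \<in> {1..Suc (Suc t)}"
  shows "mini_graph (Suc (Suc t)) (add_mini_vertex (Suc t) T i)"
  using assms by (cases "edges T") (fastforce simp: mini_graph_def add_mini_vertex_def)+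

lemma pmf_embed_pmf_finite:
  fixes f :: "nat \<Rightarrow> real"
  assumes "finite A" "\<And>x. f x \<ge> 0" "\<And>x. x \<notin> A \<Longrightarrow> f x = 0" "sum f A = 1"
  shows "pmf (embed_pmf f) = f"
proof
  fix x
  have "(\<integral>\<^sup>+x. ennreal (f x) \<partial>count_space UNIV) = (\<Sum>x\<in>A. ennreal (f x))"
    using assms by (intro nn_integral_count_space'[OF assms(1)]) auto
  also have "\<dots> = 1" using assms by (simp add: sum_ennreal)
  finally show "pmf (embed_pmf f) x = f x"
    using assms(2) by (intro pmf_embed_pmf) auto
qed

lemma pmf_endpoint:
  assumes "mini_graph t T"
  shows "pmf (endpoint t T) s =
    (if s \<in> {1..t} then real (degree T s) / (2 * real t + 1)
     else if s = t + 1 then 1 / (2 * real t + 1) else 0)"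
proof -
  let ?f = "\<lambda>s. if s \<in> {1..t} then real (degree T s) / (2 * real t + 1)
     else if s = t + 1 then 1 / (2 * real t + 1) else 0"
  have "(\<Sum>s\<in>{1..t}. degree T s) = 2 * t"
    using assms sum_edge_degree_list[of "{1..t}" "edges T"]
    by (simp add: degree_def mini_graph_def)
  then have d: "(\<Sum>s\<in>{1..t}. real (degree T s)) = 2 * real t"
    by (metis of_nat_mult of_nat_numeral of_nat_sum)
  have "sum ?f {1..Suc t} = (\<Sum>s\<in>{1..t}. real (degree T s) / (2 * real t + 1)) + 1 / (2 * real t + 1)"
    by (simp add: sum.cl_ivl_Suc)
  also have "\<dots> = 1"
    unfolding sum_divide_distrib[symmetric] d by (simp add: add_divide_distrib[symmetric])
  finally have "pmf (embed_pmf ?f) = ?f"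
    by (intro pmf_embed_pmf_finite[of "{1..Suc t}"]) auto
  then show ?thesis by (simp add: endpoint_def fun_eq_iff)
qed

lemma pmf_endpoint':
  assumes "mini_graph t T" "t \<ge> 1"
  shows "pmf (endpoint' t T) s =
    (if s \<in> {1..t} then real (degree' T s) / (2 * real t - 1) else 0)"
proof -
  let ?f = "\<lambda>s. if s \<in> {1..t} then real (degree' T s) / (2 * real t - 1) else 0"
  obtain es where es: "edges T = Upair 1 1 # es"
    using assms by (cases "edges T") (auto simp: mini_graph_def)
  have "(\<Sum>s\<in>{1..t}. degree' T s) =
      (\<Sum>s\<in>{1..t}. if s = 1 then 1 else 0) + (\<Sum>s\<in>{1..t}. \<Sum>e\<leftarrow>es. edge_degree e s)"
    by (simp add: degree'_def es sum.distrib)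
  also have "\<dots> = 1 + 2 * length es"
    using assms sum_edge_degree_list[of "{1..t}" es] by (simp add: mini_graph_def es)
  finally have "(\<Sum>s\<in>{1..t}. degree' T s) + 1 = 2 * t"
    using assms by (auto simp: mini_graph_def es)
  then have d: "(\<Sum>s\<in>{1..t}. real (degree' T s)) = 2 * real t - 1"
    by (metis add_diff_cancel_right' of_nat_1 of_nat_add of_nat_mult of_nat_numeral of_nat_sum)
  have "sum ?f {1..t} = (\<Sum>s\<in>{1..t}. real (degree' T s) / (2 * real t - 1))"
    by simp
  also have "\<dots> = 1"
    unfolding sum_divide_distrib[symmetric] d using assms(2) by simp
  finally have "pmf (embed_pmf ?f) = ?f"
    using assms(2) by (intro pmf_embed_pmf_finite[of "{1..t}"]) auto
  then show ?thesis by (simp add: endpoint'_def fun_eq_iff)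
qed

lemma mini_graph_mini_tree:
  "T \<in> set_pmf (mini_tree (Suc t)) \<Longrightarrow> mini_graph (Suc t) T"
proof (induction t arbitrary: T)
  case 0
  then show ?case using mini_graph_initial_loop by simp
next
  case (Suc t)
  then obtain T' i where T': "T' \<in> set_pmf (mini_tree (Suc t))"
    "i \<in> set_pmf (endpoint (Suc t) T')" "T = add_mini_vertex (Suc t) T' i" by auto
  have "i \<in> {1..Suc (Suc t)}"
    using T'(2) pmf_endpoint[OF Suc.IH[OF T'(1)], of i] by (auto simp: set_pmf_iff split: if_splits)
  then show ?case using mini_graph_add_mini_vertex[OF Suc.IH[OF T'(1)]] T'(3) by simp
qed

lemma mini_graph_mini_tree':
  "T \<in> set_pmf (mini_tree' (Suc t)) \<Longrightarrow> mini_graph (Suc t) T"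
proof (induction t arbitrary: T)
  case 0
  then show ?case using mini_graph_initial_loop by simp
next
  case (Suc t)
  then obtain T' i where T': "T' \<in> set_pmf (mini_tree' (Suc t))"
    "i \<in> set_pmf (endpoint' (Suc t) T')" "T = add_mini_vertex (Suc t) T' i" by auto
  have "i \<in> {1..Suc (Suc t)}"
    using T'(2) pmf_endpoint'[OF Suc.IH[OF T'(1)], of i] by (auto simp: set_pmf_iff split: if_splits)
  then show ?case using mini_graph_add_mini_vertex[OF Suc.IH[OF T'(1)]] T'(3) by simp
qed

lemma pmf_endpoint_mini_tree:
  assumes "t \<ge> 1" "T \<in> set_pmf (mini_tree t)"
  shows "pmf (endpoint t T) s =
    (if s \<in> {1..t} then real (degree T s) / (2 * real t + 1)
     else if s = t + 1 then 1 / (2 * real t + 1) else 0)"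
  using assms by (intro pmf_endpoint) (cases t; auto intro: mini_graph_mini_tree)

lemma pmf_endpoint'_mini_tree':
  assumes "t \<ge> 1" "T \<in> set_pmf (mini_tree' t)"
  shows "pmf (endpoint' t T) s =
    (if s \<in> {1..t} then real (degree' T s) / (2 * real t - 1) else 0)"
  using assms by (intro pmf_endpoint') (cases t; auto intro: mini_graph_mini_tree')

end

theory Submission
  imports Defs "HOL-Real_Asymp.Real_Asymp"
begin

text \<open>
  The proof is a union bound over the vertex sets $S$ with $|S| = k \le un$ that could violate the
  claimed expansion, so everything rests on a good estimate of the probability that a fixed $S$ has
  few cut edges.

  \<^bold>\<open>One set.\<close> Split the mini-vertices into those lying in blocks of $S$ and the rest, and let
  \<open>p\<close>, \<open>q\<close>, \<open>c\<close> be the numbers of edges inside the first part, inside the second part and across.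
  The total degree of the first part is $2p + c$, so a new mini-vertex of the first part is joined
  to its own part with probability at most $(2p + c + 1)/(2t + 1)$ when \<open>t\<close> edges are present.
  The pair \<open>(p, q)\<close> is therefore a Markov chain with explicit transition probabilities. Bounding
  the probability of every crossing step by 1, an induction over the process in which the positions
  of the crossing edges are counted by Pascal's rule (\<open>attachment_step\<close>) gives
  \[ P(p, q) \le {a \choose p}{b \choose q}
       \frac{\prod_{i<p}(2i+1+c)\prod_{i<q}(2i+1+c)}{\prod_{i<p+q}(2i+1)}, \]
  where \<open>a\<close> and \<open>b\<close> are the sizes of the two parts. The second model is the same chain if mini-vertex
  1 and its half-loop are left out of the counts: the half-loop accounts for the $+1$ of the part
  that contains it.

  \<^bold>\<open>Estimating the bound.\<close> Going from \<open>c\<close> to $c + 2$ multiplies the quotient by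
  $(2p+1+c)(2q+1+c)/(1+c)^2$, which by the inequality of arithmetic and geometric means is at most
  $(p+q+c+2)(p+q+c+1)/(1+c)^2$. Hence the quotient is at most
  $2^c {p+q+c \choose c}/{p+q \choose p}$ (\<open>side_ratio_bound\<close>). Summing over all states with
  $c \le y$ bounds the probability of at most \<open>y\<close> cut edges by
  $4^y (eN/y)^{2y} / {N \choose hk}$ with $N = hn$, up to a correction in the second model
  that averages out over the sets $S$ (\<open>sum_weight_le\<close>).

  \<^bold>\<open>All sets.\<close> There are ${n \choose k}$ sets of size \<open>k\<close>, and
  ${n \choose k}/{hn \choose hk} \le {n \choose k}^{-(h-1)}$ since ${n \choose k}^h \le {hn \choose hk}$.
  The estimate ${n \choose k} \ge (2n/k)^k/(2k)$, valid for $2k \le n$, yields a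
  factor $2^{-(h-1)k}$ that pays for $4^y$ when $y = hxk$ and $2hx \le h - 1$. What remains is, up
  to the polynomial $(2k)^{h-1}$,
  \[ \Big[ (e/x)^{2hx} (k/n)^{h-1-2hx} \Big]^k. \]
  The bracket increases with \<open>k\<close>, and at $k = un$ it is
  less than 1 precisely by the hypothesis. The terms with $k \le \sqrt n$ therefore form a geometric
  series of ratio $O(n^{-(h-1-2hx)/2})$ and the others are exponentially small in $\sqrt n$
  (\<open>union_bound_sum_small\<close>). The assumption $2hx < h - 1$ costs nothing: the hypothesis is
  preserved when \<open>x\<close> is made smaller (\<open>powr_scale_mono\<close>), and \<open>\<alpha>\<close> leaves room for that.
\<close>

section \<open>A bound that propagates along the process\<close>

text \<open>The numerators are the weights of the steps that stay inside a side, with the number of crossing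
  edges replaced by its final value \<open>c\<close>; the denominator takes the normalisations
  $2t + 1$ to be as small as possible.\<close>

definition side_ratio :: "nat \<Rightarrow> nat \<Rightarrow> nat \<Rightarrow> real" where
  "side_ratio p q c =
     (\<Prod>i<p. real (2 * i + 1 + c)) * (\<Prod>i<q. real (2 * i + 1 + c)) / (\<Prod>i<p + q. real (2 * i + 1))"

text \<open>Bounds the probability that a partition into sides of sizes \<open>a\<close> and \<open>b\<close> has \<open>p\<close> edges inside the
  first side and \<open>q\<close> inside the second. The binomial coefficients choose which mini-vertices send
  their edge to their own side.\<close>

definition state_bound :: "nat \<Rightarrow> nat \<Rightarrow> nat \<Rightarrow> nat \<Rightarrow> real" where
  "state_bound a b p q = real (a choose p) * real (b choose q) * side_ratio p q (a + b - p - q)"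

lemma side_ratio_nonneg: "side_ratio p q c \<ge> 0"
  unfolding side_ratio_def by (intro divide_nonneg_nonneg mult_nonneg_nonneg prod_nonneg) auto

lemma side_ratio_commute: "side_ratio p q c = side_ratio q p c"
  by (simp add: side_ratio_def add.commute mult.commute)

lemma side_ratio_mono: "c \<le> d \<Longrightarrow> side_ratio p q c \<le> side_ratio p q d"
  unfolding side_ratio_def
  by (intro divide_right_mono mult_mono prod_mono prod_nonneg) (auto)

lemma side_ratio_Suc:
  "side_ratio (Suc p) q c = side_ratio p q c * (real (2 * p + 1 + c) / real (2 * (p + q) + 1))"
  by (simp add: side_ratio_def field_simps)

lemma state_bound_nonneg: "state_bound a b p q \<ge> 0"
  by (simp add: state_bound_def side_ratio_nonneg)

lemma state_bound_commute: "state_bound a b p q = state_bound b a q p"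
  by (simp add: state_bound_def side_ratio_commute[of p] add.commute mult.commute diff_commute)

lemma state_bound_eq_0: "a < p \<or> b < q \<Longrightarrow> state_bound a b p q = 0"
  by (auto simp: state_bound_def)

lemma state_bound_mono: "state_bound a b p q \<le> state_bound (Suc a) b p q"
  unfolding state_bound_def
  by (intro mult_mono side_ratio_mono) (auto intro: binomial_right_mono side_ratio_nonneg)

text \<open>Pascal's rule for \<open>Suc a choose Suc p\<close>: the first summand is a state whose newest edge stays
  inside its side, the second one a state whose newest edge crosses. Note that $2p + c + 1 = t + 1 + p - q$
  for $t = a + b = p + q + c$.\<close>

lemma state_bound_Suc:
  "state_bound a b p q * ((real (a + b) + 1 + real p - real q) / (2 * real (a + b) + 1)) + state_bound a b (Suc p) q
     \<le> state_bound (Suc a) b (Suc p) q"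
proof (cases "p \<le> a \<and> q \<le> b")
  case False
  then have "p > a \<or> q > b" by auto
  then have "state_bound a b p q = 0" by (rule state_bound_eq_0)
  then show ?thesis using state_bound_mono[of a b "Suc p" q] by simp
next
  case True
  define c where "c = a + b - p - q"
  have c: "real (a + b) = real (p + q + c)" "Suc a + b - Suc p - q = c" using True by (auto simp: c_def)
  have "(real (a + b) + 1 + real p - real q) / (2 * real (a + b) + 1)
      = real (2 * p + 1 + c) / (2 * real (a + b) + 1)"
    using c by simp
  also have "\<dots> \<le> real (2 * p + 1 + c) / real (2 * (p + q) + 1)"
    using c by (intro divide_left_mono) auto
  finally have "side_ratio p q c * ((real (a + b) + 1 + real p - real q) / (2 * real (a + b) + 1))
      \<le> side_ratio (Suc p) q c"
    unfolding side_ratio_Suc by (intro mult_left_mono side_ratio_nonneg) auto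
  then have "state_bound a b p q * ((real (a + b) + 1 + real p - real q) / (2 * real (a + b) + 1))
      \<le> real (a choose p) * real (b choose q) * side_ratio (Suc p) q c"
    unfolding state_bound_def c_def[symmetric] mult.assoc by (intro mult_left_mono) auto
  moreover have "state_bound a b (Suc p) q \<le> real (a choose Suc p) * real (b choose q) * side_ratio (Suc p) q c"
    unfolding state_bound_def by (intro mult_left_mono side_ratio_mono) (auto simp: c_def)
  moreover have "state_bound (Suc a) b (Suc p) q
      = real (a choose p) * real (b choose q) * side_ratio (Suc p) q c
        + real (a choose Suc p) * real (b choose q) * side_ratio (Suc p) q c"
    unfolding state_bound_def c(2) by (simp add: algebra_simps)
  ultimately show ?thesis by linarith
qed

text \<open>One step of a Markov chain that adds a mini-vertex to the first side: the count \<open>P\<close> either stays or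
  grows by one, and only the probability of growing has to be controlled.\<close>

lemma state_bound_step:
  fixes M :: "'a pmf" and K :: "'a \<Rightarrow> 'b pmf"
  assumes bound: "\<And>p q. measure_pmf.prob M {x. P x = p \<and> Q x = q} \<le> state_bound a b p q"
    and Q: "\<And>x y. x \<in> set_pmf M \<Longrightarrow> y \<in> set_pmf (K x) \<Longrightarrow> Q' y = Q x"
    and P: "\<And>x y. x \<in> set_pmf M \<Longrightarrow> y \<in> set_pmf (K x) \<Longrightarrow> P' y = P x \<or> P' y = Suc (P x)"
    and inc: "\<And>x. x \<in> set_pmf M \<Longrightarrow> measure_pmf.prob (K x) {y. P' y = Suc (P x)}
                 \<le> (real (a + b) + 1 + real (P x) - real (Q x)) / (2 * real (a + b) + 1)"
  shows "measure_pmf.prob (bind_pmf M K) {y. P' y = p \<and> Q' y = q} \<le> state_bound (Suc a) b p q"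
proof -
  define r where "r p = (real (a + b) + 1 + real p - real q) / (2 * real (a + b) + 1)" for p
  define A where "A p = {x. P x = p \<and> Q x = q}" for p
  have int: "integrable (measure_pmf M) (indicator (A p) :: 'a \<Rightarrow> real)" for p
    by (auto intro: measure_pmf.integrable_const_bound[where B = 1])
  have mono: "measure_pmf.prob (bind_pmf M K) {y. P' y = p \<and> Q' y = q}
      \<le> measure_pmf.expectation M g"
    if g: "\<And>x. x \<in> set_pmf M \<Longrightarrow> measure_pmf.prob (K x) {y. P' y = p \<and> Q' y = q} \<le> g x"
    and "integrable (measure_pmf M) g" for g
  proof -
    have "measure_pmf.prob (bind_pmf M K) {y. P' y = p \<and> Q' y = q}
        = measure_pmf.expectation M (\<lambda>x. measure_pmf.prob (K x) {y. P' y = p \<and> Q' y = q})"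
      unfolding measure_pmf_bind
      by (rule measure_pmf.measure_bind[where N = "count_space UNIV"])
        (simp_all add: measure_pmf_in_subprob_algebra)
    also have "\<dots> \<le> measure_pmf.expectation M g"
      by (intro integral_mono_AE that(2))
        (auto intro: measure_pmf.integrable_const_bound[where B = 1] simp: AE_measure_pmf_iff g)
    finally show ?thesis .
  qed
  show ?thesis
  proof (cases p)
    case 0
    have "measure_pmf.prob (bind_pmf M K) {y. P' y = p \<and> Q' y = q}
        \<le> measure_pmf.expectation M (indicator (A 0))"
    proof (intro mono)
      fix x assume x: "x \<in> set_pmf M"
      show "measure_pmf.prob (K x) {y. P' y = p \<and> Q' y = q} \<le> indicator (A 0) x"
      proof (cases "x \<in> A 0")
        case False
        have "measure_pmf.prob (K x) {y. P' y = p \<and> Q' y = q} = 0"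
          using P[OF x] Q[OF x] False 0 by (fastforce simp: measure_pmf_zero_iff A_def)
        then show ?thesis by simp
      qed simp
    qed (rule int)
    also have "\<dots> \<le> state_bound a b 0 q" using bound[of 0 q] by (simp add: A_def)
    also have "\<dots> \<le> state_bound (Suc a) b 0 q" by (rule state_bound_mono)
    finally show ?thesis using 0 by simp
  next
    case (Suc p')
    have "measure_pmf.prob (bind_pmf M K) {y. P' y = p \<and> Q' y = q}
        \<le> measure_pmf.expectation M (\<lambda>x. indicator (A p') x * r p' + indicator (A p) x)"
    proof (intro mono)
      fix x assume x: "x \<in> set_pmf M"
      show "measure_pmf.prob (K x) {y. P' y = p \<and> Q' y = q}
          \<le> indicator (A p') x * r p' + indicator (A p) x"
      proof (cases "x \<in> A p")
        case True
        then have "x \<notin> A p'" using Suc by (auto simp: A_def)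
        then show ?thesis using True by simp
      next
        case notp: False
        show ?thesis
        proof (cases "x \<in> A p'")
          case True
          have "measure_pmf.prob (K x) {y. P' y = p \<and> Q' y = q}
              \<le> measure_pmf.prob (K x) {y. P' y = Suc (P x)}"
            using True Suc by (intro measure_pmf.finite_measure_mono) (auto simp: A_def)
          also have "\<dots> \<le> r p'" using inc[OF x] True by (simp add: A_def r_def)
          finally show ?thesis using True notp by simp
        next
          case False
          have "measure_pmf.prob (K x) {y. P' y = p \<and> Q' y = q} = 0"
            using P[OF x] Q[OF x] False notp Suc by (fastforce simp: measure_pmf_zero_iff A_def)
          then show ?thesis using False notp by simp
        qed
      qed
    qed (intro Bochner_Integration.integrable_add integrable_mult_left int)
    also have "\<dots> = measure_pmf.prob M (A p') * r p' + measure_pmf.prob M (A p)"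
      using int by (subst Bochner_Integration.integral_add) (auto intro: integrable_mult_left)
    also have "\<dots> \<le> state_bound a b p' q * r p' + state_bound a b p q"
    proof (intro add_mono)
      show "measure_pmf.prob M (A p') * r p' \<le> state_bound a b p' q * r p'"
      proof (cases "r p' \<ge> 0")
        case True
        then show ?thesis using bound[of p' q] by (intro mult_right_mono) (auto simp: A_def)
      next
        \<comment> \<open>The formula for the weight is negative only at states of probability zero.\<close>
        case False
        then have "q > b" by (auto simp: r_def field_simps not_le divide_less_0_iff)
        then have 0: "state_bound a b p' q = 0" by (intro state_bound_eq_0) auto
        then have "measure_pmf.prob M (A p') = 0"
          using bound[of p' q] by (simp add: A_def measure_le_0_iff)
        then show ?thesis using 0 by simp
      qed
    qed (use bound[of p q] in \<open>simp add: A_def\<close>)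
    also have "\<dots> \<le> state_bound (Suc a) b p q"
      using state_bound_Suc[of a b p' q] Suc by (simp add: r_def)
    finally show ?thesis .
  qed
qed

section \<open>Estimates for the bound\<close>

text \<open>Compare factor by factor: $(2i+1)/(2(i+q)+1) \le (i+1)/(i+q+1)$.\<close>

lemma side_ratio_0: "side_ratio p q 0 \<le> 1 / real ((p + q) choose p)"
proof (induction p)
  case 0
  show ?case by (simp add: side_ratio_def prod_nonneg) 
next
  case (Suc p)
  have "real ((p + q) choose p) * real (p + q + 1) = real ((Suc p + q) choose Suc p) * real (p + 1)"
    using Suc_times_binomial[of p "p + q"] by (metis Suc_eq_plus1 add_Suc mult.commute of_nat_mult)
  then have eq: "1 / real ((p + q) choose p) * (real (p + 1) / real (p + q + 1))
      = 1 / real ((Suc p + q) choose Suc p)"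
    by (simp add: divide_simps del: binomial_Suc_Suc of_nat_add of_nat_Suc) 
  have "side_ratio (Suc p) q 0 = side_ratio p q 0 * (real (2 * p + 1 + 0) / real (2 * (p + q) + 1))"
    by (rule side_ratio_Suc)
  also have "\<dots> \<le> 1 / real ((p + q) choose p) * (real (p + 1) / real (p + q + 1))"
    by (intro mult_mono Suc.IH) (auto simp: divide_simps algebra_simps)
  finally show ?case unfolding eq .
qed

text \<open>For $c = 1$ the numerators are $2^p p!$ and $2^q q!$, and $2^m m!$ exceeds
  $1 \cdot 3 \cdots (2m-1)$ by a factor of at most $m + 1$.\<close>

lemma side_ratio_1: "side_ratio p q 1 \<le> real (p + q + 1) / real ((p + q) choose p)"
proof -
  have f: "(\<Prod>i<m. real (2 * i + 1 + 1)) = 2 ^ m * fact m" for m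
    by (induction m) (simp_all add: algebra_simps)
  have r: "2 ^ m * fact m \<le> real (m + 1) * (\<Prod>i<m. real (2 * i + 1))" for m
  proof (induction m)
    case (Suc m)
    have "real (2 * m + 2) * real (m + 1) \<le> real (m + 2) * real (2 * m + 1)"
      unfolding of_nat_mult[symmetric] of_nat_le_iff by (simp add: algebra_simps)
    then have *: "(\<Prod>i<m. real (2 * i + 1)) * (real (2 * m + 2) * real (m + 1))
        \<le> (\<Prod>i<m. real (2 * i + 1)) * (real (m + 2) * real (2 * m + 1))"
      by (intro mult_left_mono prod_nonneg) auto
    have "2 ^ Suc m * fact (Suc m) = real (2 * m + 2) * (2 ^ m * fact m)"
      by (simp add: algebra_simps)
    also have "\<dots> \<le> real (2 * m + 2) * (real (m + 1) * (\<Prod>i<m. real (2 * i + 1)))"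
      by (intro mult_left_mono Suc.IH) auto
    also have "\<dots> \<le> real (Suc m + 1) * (\<Prod>i<Suc m. real (2 * i + 1))"
      using * by (simp add: mult_ac)
    finally show ?case .
  qed simp
  have pos: "(\<Prod>i<p + q. real (2 * i + 1)) > 0" by (intro prod_pos) auto
  have b: "real ((p + q) choose p) = fact (p + q) / (fact p * fact q)"
    by (simp add: binomial_fact)
  have "side_ratio p q 1 * real ((p + q) choose p) = 2 ^ (p + q) * fact (p + q) / (\<Prod>i<p + q. real (2 * i + 1))"
    unfolding side_ratio_def f b by (simp add: power_add)
  also have "\<dots> \<le> real (p + q + 1)"
    using r[of "p + q"] pos by (simp only: pos_divide_le_eq) 
  finally show ?thesis by (simp add: pos_le_divide_eq)
qed

text \<open>Replacing \<open>c\<close> by $c + 2$ shifts the index, so the product telescopes.\<close>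

lemma prod_shift_by_2:
  "(\<Prod>i<p. real (2 * i + 1 + (c + 2))) * real (c + 1) = (\<Prod>i<p. real (2 * i + 1 + c)) * real (2 * p + 1 + c)"
proof (induction p)
  case (Suc p)
  have "(\<Prod>i<Suc p. real (2 * i + 1 + (c + 2))) * real (c + 1)
     = ((\<Prod>i<p. real (2 * i + 1 + (c + 2))) * real (c + 1)) * real (2 * p + 1 + (c + 2))"
    by (simp add: mult_ac)
  also have "\<dots> = (\<Prod>i<Suc p. real (2 * i + 1 + c)) * real (2 * Suc p + 1 + c)"
    unfolding Suc.IH by (simp add: mult_ac)
  finally show ?case .
qed simp

lemma side_ratio_add_2:
  "side_ratio p q (c + 2) * (real (c + 1))\<^sup>2 = side_ratio p q c * (real (2 * p + 1 + c) * real (2 * q + 1 + c))"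
proof -
  have "side_ratio p q (c + 2) * (real (c + 1))\<^sup>2
    = ((\<Prod>i<p. real (2 * i + 1 + (c + 2))) * real (c + 1)) * ((\<Prod>i<q. real (2 * i + 1 + (c + 2))) * real (c + 1))
      / (\<Prod>i<p + q. real (2 * i + 1))"
    by (simp add: side_ratio_def power2_eq_square mult_ac del: of_nat_add)
  also have "\<dots> = side_ratio p q c * (real (2 * p + 1 + c) * real (2 * q + 1 + c))"
    unfolding prod_shift_by_2 by (simp add: side_ratio_def mult_ac)
  finally show ?thesis .
qed

text \<open>Induction in steps of two from the cases $c = 0$ and $c = 1$. In the step,
  $(2p+1+c)(2q+1+c) \le (p+q+c+1)^2$, and comparing with ${p+q+c+2 \choose c+2}$ costs the factor
  $(c+2)/(c+1) \le 4$. It matters that no factor growing with \<open>p + q\<close> is lost: even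
  a small power of \<open>n\<close> could spoil the sum over small sets.\<close>

lemma side_ratio_bound:
  "side_ratio p q c \<le> 2 ^ c * real ((p + q + c) choose c) / real ((p + q) choose p)"
proof (induction c rule: nat_induct2)
  case 0
  then show ?case using side_ratio_0[of p q] by simp
next
  case 1
  have "real (p + q + 1) / real ((p + q) choose p) \<le> 2 ^ 1 * real ((p + q + 1) choose 1) / real ((p + q) choose p)"
    by (intro divide_right_mono) auto
  then show ?case using side_ratio_1[of p q] by linarith
next
  case (step c)
  define m where "m = p + q"
  define B where "B = real ((p + q) choose p)"
  have B: "B > 0" by (simp add: B_def)
  have "real (2 * p + 1 + c) * real (2 * q + 1 + c) \<le> (real (m + c + 1))\<^sup>2"
    using sum_squares_ge_zero[of "real p - real q" 0]
    by (simp add: m_def power2_eq_square algebra_simps)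
  also have "\<dots> \<le> real (m + c + 2) * real (m + c + 1)"
    by (simp add: power2_eq_square mult_right_mono)
  finally have 1: "real (2 * p + 1 + c) * real (2 * q + 1 + c) \<le> real (m + c + 2) * real (m + c + 1)" .
  have s1: "real (c + 1) * real ((m + c + 1) choose (c + 1)) = real (m + c + 1) * real ((m + c) choose c)"
    using Suc_times_binomial[of c "m + c"] by (metis Suc_eq_plus1 of_nat_mult)
  have s2: "real (c + 2) * real ((m + c + 2) choose (c + 2)) = real (m + c + 2) * real ((m + c + 1) choose (c + 1))"
    using Suc_times_binomial[of "c + 1" "m + c + 1"]
    by (metis Suc_eq_plus1 add.assoc nat_1_add_1 of_nat_mult)
  have "side_ratio p q (c + 2) * (real (c + 1))\<^sup>2 
      \<le> (2 ^ c * real ((m + c) choose c) / B) * (real (m + c + 2) * real (m + c + 1))"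
    unfolding side_ratio_add_2 using step by (intro mult_mono[OF _ 1]) (auto simp: B_def m_def)
  also have "\<dots> = 2 ^ c * (real (m + c + 2) * (real (m + c + 1) * real ((m + c) choose c))) / B"
    by simp
  also have "\<dots> = 2 ^ c * (real (c + 1) * (real (c + 2) * real ((m + c + 2) choose (c + 2)))) / B"
    unfolding s1[symmetric] s2 by simp
  also have "\<dots> \<le> 2 ^ c * (real (c + 1) * (4 * real (c + 1) * real ((m + c + 2) choose (c + 2)))) / B"
    using B by (intro divide_right_mono mult_left_mono mult_right_mono) auto
  also have "\<dots> = (2 ^ (c + 2) * real ((m + c + 2) choose (c + 2)) / B) * (real (c + 1))\<^sup>2"
    by (simp add: power2_eq_square del: binomial_Suc_Suc)
  finally have "side_ratio p q (c + 2) \<le> 2 ^ (c + 2) * real ((m + c + 2) choose (c + 2)) / B"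
    by (rule mult_right_le_imp_le) simp
  then show ?case by (simp add: m_def B_def add.assoc del: binomial_Suc_Suc)
qed

text \<open>Both sides are $a!\,b!/((a-p)!\,(b-q)!\,(p+q)!)$.\<close>

lemma binomial_product_div_binomial:
  assumes "p \<le> a" "q \<le> b"
  shows "real (a choose p) * real (b choose q) / real ((p + q) choose p)
    = real ((a + b) choose (a + b - p - q)) * real ((a + b - p - q) choose (a - p)) / real ((a + b) choose a)"
proof -
  obtain i where a: "a = p + i" using assms(1) by (auto simp: le_iff_add)
  obtain j where b: "b = q + j" using assms(2) by (auto simp: le_iff_add)
  have c: "a + b - p - q = i + j" "a + b = (p + q) + (i + j)" by (auto simp: a b)
  have f: "real ((x + y) choose x) = fact (x + y) / (fact x * fact y)"
     "real ((y + x) choose x) = fact (x + y) / (fact x * fact y)" for x y :: nat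
    by (simp_all add: binomial_fact add.commute)
  have 1: "real (a choose p) = fact a / (fact p * fact i)" "real (b choose q) = fact b / (fact q * fact j)"
    by (simp_all add: a b f)
  have 2: "real ((a + b) choose (i + j)) = fact (a + b) / (fact (i + j) * fact (p + q))"
    unfolding c(2) by (simp only: f add.commute)
  have 3: "real ((a + b) choose a) = fact (a + b) / (fact a * fact b)" "real ((p + q) choose p) = fact (p + q) / (fact p * fact q)"
     "real ((i + j) choose i) = fact (i + j) / (fact i * fact j)" by (rule f)+
  have 4: "a - p = i" by (simp add: a)
  show ?thesis unfolding c(1) 1 2 3 4 by simp
qed

lemma state_bound_le:
  assumes "p \<le> a" "q \<le> b" and c: "c = a + b - p - q"
  shows "state_bound a b p q
    \<le> 2 ^ c * (real ((a + b) choose c))\<^sup>2 * real (c choose (a - p)) / real ((a + b) choose a)"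
proof -
  have "state_bound a b p q
      \<le> real (a choose p) * real (b choose q) * (2 ^ c * real ((p + q + c) choose c) / real ((p + q) choose p))"
    unfolding state_bound_def c[symmetric] by (intro mult_left_mono side_ratio_bound) auto
  also have "\<dots> = 2 ^ c * real ((a + b) choose c) * (real (a choose p) * real (b choose q) / real ((p + q) choose p))"
    using assms by (simp add: mult_ac)
  also have "\<dots> = 2 ^ c * (real ((a + b) choose c))\<^sup>2 * real (c choose (a - p)) / real ((a + b) choose a)"
    unfolding binomial_product_div_binomial[OF assms(1,2)] c by (simp add: power2_eq_square)
  finally show ?thesis .
qed

text \<open>The exponential-moment estimate of a binomial tail: multiply each term by $z^{c-y} \ge 1$ with
  $z = y/N$ and use $(1 + z)^N \le e^{zN} = e^y$.\<close>

lemma sum_choose_le: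
  fixes y :: real
  assumes "0 < y" "y \<le> real N" "t \<le> N"
  shows "(\<Sum>c | real c \<le> y. real (t choose c)) \<le> (exp 1 * real N / y) powr y"
proof -
  define z where "z = y / real N"
  have z: "0 < z" "z \<le> 1" using assms by (auto simp: z_def)
  have fin: "finite {c. real c \<le> y}"
    by (rule finite_subset[of _ "{..nat \<lfloor>y\<rfloor>}"]) (auto simp: le_nat_floor)
  have "(\<Sum>c | real c \<le> y. real (t choose c)) \<le> (\<Sum>c | real c \<le> y. real (N choose c))"
    using assms by (intro sum_mono) (auto intro: binomial_right_mono)
  also have "\<dots> \<le> (\<Sum>c | real c \<le> y. real (N choose c) * (z ^ c * z powr (-y)))"
  proof (intro sum_mono)
    fix c assume "c \<in> {c. real c \<le> y}"
    then have "z powr 0 \<le> z powr (real c - y)" using z by (intro powr_mono') auto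
    also have "\<dots> = z ^ c * z powr (-y)" using z by (simp add: powr_diff powr_realpow powr_minus divide_inverse)
    finally have "1 \<le> z ^ c * z powr (-y)" using z by simp
    then show "real (N choose c) \<le> real (N choose c) * (z ^ c * z powr (-y))"
      by (simp add: mult_le_cancel_left1)
  qed
  also have "\<dots> \<le> (\<Sum>c\<le>N. real (N choose c) * (z ^ c * z powr (-y)))"
    using assms z by (intro sum_mono2) (auto intro!: mult_nonneg_nonneg)
  also have "\<dots> = (z + 1) ^ N * z powr (-y)"
    by (simp add: binomial_ring sum_distrib_right sum_distrib_left mult_ac)
  also have "\<dots> \<le> exp z ^ N * z powr (-y)"
  proof (intro mult_right_mono power_mono)
    show "z + 1 \<le> exp z" using exp_ge_add_one_self[of z] by linarith
  qed (use z in auto)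
  also have "exp z ^ N = exp y" using assms by (simp add: z_def flip: exp_of_nat_mult)
  also have "exp y = exp 1 powr y" by (simp add: powr_def)
  also have "z powr (-y) = (real N / y) powr y"
    using assms by (simp add: z_def powr_minus powr_divide)
  also have "exp 1 powr y * (real N / y) powr y = (exp 1 * real N / y) powr y"
    using assms by (simp flip: powr_mult)
  finally show ?thesis .
qed

text \<open>With $c$ crossing edges fixed, summing over the number $a - p$ of crossing edges that start in the
  first side turns $c \choose a-p$ into $2^c$. The sum of the squares of the remaining coefficients is
  bounded by the square of their sum.\<close>

lemma sum_state_bound_le:
  fixes y :: real
  assumes "0 < y" "y \<le> real N" "a + b \<le> N"
  shows "(\<Sum>(p, q) | p \<le> a \<and> q \<le> b \<and> real (a + b - p - q) \<le> y. state_bound a b p q)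
    \<le> 4 powr y * (exp 1 * real N / y) powr (2 * y) / real ((a + b) choose a)"
proof -
  define Ind where "Ind = {(p, q). p \<le> a \<and> q \<le> b \<and> real (a + b - p - q) \<le> y}"
  define C where "C = {c. real c \<le> y}"
  define t where "t = a + b"
  define g where "g = (\<lambda>(p, q). (a + b - p - q, a - p))"
  define w where "w = (\<lambda>(c, i). 2 ^ c * (real (t choose c))\<^sup>2 * real (c choose i) / real (t choose a))"
  have finC: "finite C" unfolding C_def
    by (rule finite_subset[of _ "{..nat \<lfloor>y\<rfloor>}"]) (auto simp: le_nat_floor)
  have inj: "inj_on g Ind" by (auto simp: inj_on_def g_def Ind_def)
  have img: "g ` Ind \<subseteq> (SIGMA c:C. {..c})" by (auto simp: g_def Ind_def C_def)
  have "(\<Sum>(p, q)\<in>Ind. state_bound a b p q) \<le> (\<Sum>x\<in>Ind. w (g x))"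
    by (intro sum_mono) (auto simp: Ind_def w_def g_def t_def intro!: state_bound_le)
  also have "\<dots> = sum w (g ` Ind)" using inj by (simp add: sum.reindex)
  also have "\<dots> \<le> sum w (SIGMA c:C. {..c})"
    using finC img by (intro sum_mono2) (auto simp: w_def)
  also have "\<dots> = (\<Sum>c\<in>C. \<Sum>i\<le>c. w (c, i))" using finC by (simp add: sum.Sigma)
  also have "\<dots> = (\<Sum>c\<in>C. 4 ^ c * (real (t choose c))\<^sup>2 / real (t choose a))"
  proof (intro sum.cong refl)
    fix c
    have "(\<Sum>i\<le>c. w (c, i)) = 2 ^ c * (real (t choose c))\<^sup>2 * real (\<Sum>i\<le>c. c choose i) / real (t choose a)"
      unfolding w_def of_nat_sum by (simp add: sum_distrib_left sum_divide_distrib)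
    also have "\<dots> = 4 ^ c * (real (t choose c))\<^sup>2 / real (t choose a)"
      using power_mult_distrib[of "2::real" 2 c] by (simp add: choose_row_sum mult_ac)
    finally show "(\<Sum>i\<le>c. w (c, i)) = 4 ^ c * (real (t choose c))\<^sup>2 / real (t choose a)" .
  qed
  also have "\<dots> \<le> (\<Sum>c\<in>C. 4 powr y * (real (t choose c))\<^sup>2 / real (t choose a))"
    by (intro sum_mono divide_right_mono mult_right_mono)
       (auto simp: C_def powr_realpow[symmetric] intro!: powr_mono)
  also have "\<dots> = 4 powr y * (\<Sum>c\<in>C. (real (t choose c))\<^sup>2) / real (t choose a)"
    by (simp add: sum_distrib_left sum_divide_distrib)
  also have "\<dots> \<le> 4 powr y * (exp 1 * real N / y) powr (2 * y) / real (t choose a)"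
  proof (intro divide_right_mono mult_left_mono)
    have "(\<Sum>c\<in>C. (real (t choose c))\<^sup>2) \<le> (\<Sum>c\<in>C. real (t choose c) * (\<Sum>c\<in>C. real (t choose c)))"
      unfolding power2_eq_square
      by (intro sum_mono mult_left_mono member_le_sum finC) auto
    also have "\<dots> = (\<Sum>c\<in>C. real (t choose c))\<^sup>2"
      by (simp add: power2_eq_square sum_distrib_right)
    also have "\<dots> \<le> ((exp 1 * real N / y) powr y)\<^sup>2"
      using sum_choose_le[OF assms(1,2), of t] assms(3) unfolding C_def t_def
      by (intro power_mono sum_nonneg) auto
    also have "\<dots> = (exp 1 * real N / y) powr (2 * y)"
      by (simp only: power2_eq_square powr_add[symmetric] mult_2)
    finally show "(\<Sum>c\<in>C. (real (t choose c))\<^sup>2) \<le> (exp 1 * real N / y) powr (2 * y)" .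
  qed auto
  finally show ?thesis by (simp add: Ind_def t_def)
qed

section \<open>Edges inside the two sides of a partition\<close>

definition inner_edges :: "nat set \<Rightarrow> nat uprod list \<Rightarrow> nat" where
  "inner_edges S es = length (filter (\<lambda>e. set_uprod e \<subseteq> S) es)"

lemma inner_edges_Nil [simp]: "inner_edges S [] = 0"
  by (simp add: inner_edges_def)

lemma inner_edges_Cons:
  "inner_edges S (e # es) = (if set_uprod e \<subseteq> S then 1 else 0) + inner_edges S es"
  by (simp add: inner_edges_def)

lemma inner_edges_snoc:
  "inner_edges S (es @ [e]) = inner_edges S es + (if set_uprod e \<subseteq> S then 1 else 0)"
  by (simp add: inner_edges_def)

text \<open>An edge contributes 2, 1 or 0 to the degree of a side according as it lies inside, crosses or
  lies outside.\<close>

lemma sum_edge_degree_subset: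
  assumes "finite A" "set_uprod e \<subseteq> A"
  shows "(\<Sum>v\<in>S \<inter> A. edge_degree e v) + (if set_uprod e \<subseteq> - S then 1 else 0)
    = 1 + (if set_uprod e \<subseteq> S then 1 else 0)"
proof (cases e)
  case (Upair a b)
  have ab: "a \<in> A" "b \<in> A" using assms Upair by auto
  show ?thesis
  proof (cases "a = b")
    case True
    have "edge_degree e v = (if v = a then 2 else 0)" for v
      using Upair True by (auto simp: edge_degree_def)
    then show ?thesis using ab assms(1) Upair True by simp
  next
    case False
    have "edge_degree e v = (if v = a then 1 else 0) + (if v = b then 1 else 0)" for v
      using Upair False by (auto simp: edge_degree_def)
    then show ?thesis using ab assms(1) Upair False by (simp add: sum.distrib)
  qed
qed

lemma sum_degree_subset:
  assumes "finite A" "\<forall>e\<in>set es. set_uprod e \<subseteq> A"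
  shows "(\<Sum>v\<in>S \<inter> A. \<Sum>e\<leftarrow>es. edge_degree e v) + inner_edges (- S) es
    = length es + inner_edges S es"
  using assms(2)
proof (induction es)
  case (Cons e es)
  then show ?case
    using sum_edge_degree_subset[OF assms(1), of e S] by (simp add: sum.distrib inner_edges_Cons)
qed simp

lemma prob_finite_support:
  assumes "finite A" "\<And>i. i \<notin> A \<Longrightarrow> pmf E i = 0"
  shows "measure_pmf.prob E S = (\<Sum>i\<in>S \<inter> A. pmf E i)"
proof -
  have "set_pmf E \<subseteq> A" using assms(2) by (meson set_pmf_iff subsetI)
  then have "measure_pmf.prob E S = measure_pmf.prob E (S \<inter> A)"
    by (intro measure_pmf.finite_measure_eq_AE) (auto simp: AE_measure_pmf_iff)
  then show ?thesis using assms(1) by (simp add: measure_measure_pmf_finite)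
qed

text \<open>The degree of the side \<open>S\<close> is $t + p - q$, and the extra 1 is the possible loop at the new
  mini-vertex.\<close>

lemma prob_endpoint:
  assumes T: "mini_graph t T" and S: "Suc t \<in> S"
  shows "measure_pmf.prob (endpoint t T) S
    = (real t + 1 + real (inner_edges S (edges T)) - real (inner_edges (- S) (edges T))) / (2 * real t + 1)"
proof -
  have "measure_pmf.prob (endpoint t T) S = (\<Sum>i\<in>S \<inter> {1..Suc t}. pmf (endpoint t T) i)"
    by (intro prob_finite_support) (auto simp: pmf_endpoint[OF T])
  also have "S \<inter> {1..Suc t} = insert (Suc t) (S \<inter> {1..t})" using S by auto
  also have "(\<Sum>i\<in>insert (Suc t) (S \<inter> {1..t}). pmf (endpoint t T) i)
      = (1 + real (\<Sum>i\<in>S \<inter> {1..t}. degree T i)) / (2 * real t + 1)"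
    by (simp add: pmf_endpoint[OF T] sum_divide_distrib add_divide_distrib)
  also have "real (\<Sum>i\<in>S \<inter> {1..t}. degree T i)
      = real t + real (inner_edges S (edges T)) - real (inner_edges (- S) (edges T))"
  proof -
    have "(\<Sum>i\<in>S \<inter> {1..t}. degree T i) + inner_edges (- S) (edges T) = t + inner_edges S (edges T)"
      using sum_degree_subset[of "{1..t}" "edges T" S] T by (simp add: degree_def mini_graph_def)
    then show ?thesis by linarith
  qed
  finally show ?thesis by (simp add: algebra_simps)
qed

text \<open>The count omits $e_1$, whose contribution to the degree of its side is at most 1.\<close>

lemma prob_endpoint':
  assumes T: "mini_graph (Suc t) T"
  shows "measure_pmf.prob (endpoint' (Suc t) T) S
    \<le> (real t + 1 + real (inner_edges S (tl (edges T))) - real (inner_edges (- S) (tl (edges T))))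
      / (2 * real t + 1)"
proof -
  obtain es where es: "edges T = Upair 1 1 # es" "length es = t" "\<forall>e\<in>set es. set_uprod e \<subseteq> {1..Suc t}"
    using T by (cases "edges T") (auto simp: mini_graph_def)
  have "measure_pmf.prob (endpoint' (Suc t) T) S
      = (\<Sum>i\<in>S \<inter> {1..Suc t}. pmf (endpoint' (Suc t) T) i)"
    by (intro prob_finite_support) (auto simp: pmf_endpoint'[OF T])
  also have "\<dots> = real (\<Sum>i\<in>S \<inter> {1..Suc t}. degree' T i) / (2 * real t + 1)"
    by (simp add: pmf_endpoint'[OF T] sum_divide_distrib add.commute)
  also have "\<dots> \<le> (real t + 1 + real (inner_edges S es) - real (inner_edges (- S) es)) / (2 * real t + 1)"
  proof (intro divide_right_mono)
    have "(\<Sum>i\<in>S \<inter> {1..Suc t}. degree' T i)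
        = (\<Sum>i\<in>S \<inter> {1..Suc t}. if i = 1 then 1 else 0) + (\<Sum>i\<in>S \<inter> {1..Suc t}. \<Sum>e\<leftarrow>es. edge_degree e i)"
      by (simp add: degree'_def es sum.distrib)
    moreover have "(\<Sum>i\<in>S \<inter> {1..Suc t}. if i = 1 then 1 else 0 :: nat) \<le> 1" by simp
    moreover have "(\<Sum>i\<in>S \<inter> {1..Suc t}. \<Sum>e\<leftarrow>es. edge_degree e i) + inner_edges (- S) es = t + inner_edges S es"
      using sum_degree_subset[of "{1..Suc t}" es S] es by simp
    ultimately have "(\<Sum>i\<in>S \<inter> {1..Suc t}. degree' T i) + inner_edges (- S) es \<le> t + 1 + inner_edges S es"
      by linarith
    then show "real (\<Sum>i\<in>S \<inter> {1..Suc t}. degree' T i)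
        \<le> real t + 1 + real (inner_edges S es) - real (inner_edges (- S) es)" by linarith
  qed simp
  finally show ?thesis by (simp add: es)
qed

section \<open>The two attachment processes\<close>

text \<open>The hypotheses treat all sides \<open>S\<close> at once because a new mini-vertex outside \<open>S\<close> is handled by
  exchanging \<open>S\<close> with its complement. The function \<open>L\<close> selects the edges that are counted, which
  lets the second model drop $e_1$.\<close>

lemma attachment_step:
  fixes M :: "'g pmf" and E :: "'g \<Rightarrow> nat pmf" and F :: "'g \<Rightarrow> nat \<Rightarrow> 'g" and L :: "'g \<Rightarrow> nat uprod list"
  assumes bound: "\<And>S p q. measure_pmf.prob M {T. inner_edges S (L T) = p \<and> inner_edges (- S) (L T) = q}
      \<le> state_bound (card (S \<inter> V)) (card (V - S)) p q"
    and V: "finite V" "v \<notin> V"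
    and L: "\<And>T i. T \<in> set_pmf M \<Longrightarrow> L (F T i) = L T @ [Upair v i]"
    and E: "\<And>S T. T \<in> set_pmf M \<Longrightarrow> v \<in> S \<Longrightarrow> measure_pmf.prob (E T) S
      \<le> (real (card V) + 1 + real (inner_edges S (L T)) - real (inner_edges (- S) (L T))) / (2 * real (card V) + 1)"
  shows "measure_pmf.prob (bind_pmf M (\<lambda>T. map_pmf (F T) (E T)))
      {T. inner_edges S (L T) = p \<and> inner_edges (- S) (L T) = q}
    \<le> state_bound (card (S \<inter> insert v V)) (card (insert v V - S)) p q"
proof -
  have *: "measure_pmf.prob (bind_pmf M (\<lambda>T. map_pmf (F T) (E T)))
      {T. inner_edges S (L T) = p \<and> inner_edges (- S) (L T) = q}
    \<le> state_bound (card (S \<inter> insert v V)) (card (insert v V - S)) p q" if v: "v \<in> S" for S p q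
  proof -
    have c: "card (S \<inter> insert v V) = Suc (card (S \<inter> V))" "card (insert v V - S) = card (V - S)"
      using V v by auto
    have cV: "card (S \<inter> V) + card (V - S) = card V"
      using V(1) by (metis Int_commute card_Int_Diff)
    show ?thesis unfolding c
    proof (rule state_bound_step[OF bound])
      fix T T' assume T: "T \<in> set_pmf M" "T' \<in> set_pmf (map_pmf (F T) (E T))"
      show "inner_edges (- S) (L T') = inner_edges (- S) (L T)"
        "inner_edges S (L T') = inner_edges S (L T) \<or> inner_edges S (L T') = Suc (inner_edges S (L T))"
        using T v by (auto simp: L inner_edges_snoc)
    next
      fix T assume T: "T \<in> set_pmf M"
      have "measure_pmf.prob (map_pmf (F T) (E T)) {T'. inner_edges S (L T') = Suc (inner_edges S (L T))}
          = measure_pmf.prob (E T) S"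
        using v by (auto simp: L[OF T] inner_edges_snoc vimage_def intro!: arg_cong[where f = "measure_pmf.prob (E T)"])
      then show "measure_pmf.prob (map_pmf (F T) (E T)) {T'. inner_edges S (L T') = Suc (inner_edges S (L T))}
          \<le> (real (card (S \<inter> V) + card (V - S)) + 1 + real (inner_edges S (L T)) - real (inner_edges (- S) (L T)))
            / (2 * real (card (S \<inter> V) + card (V - S)) + 1)"
        using E[OF T v] unfolding cV by simp
    qed
  qed
  show ?thesis
  proof (cases "v \<in> S")
    case True
    then show ?thesis by (rule *)
  next
    case False
    have "- S \<inter> insert v V = insert v V - S" "insert v V - - S = S \<inter> insert v V" by auto
    then show ?thesis using *[of "- S" q p] False by (simp add: conj_commute state_bound_commute[of _ _ q p])
  qed
qed

lemma edges_add_mini_vertex: "edges (add_mini_vertex t T i) = edges T @ [Upair (Suc t) i]"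
  by (simp add: add_mini_vertex_def)

lemma mini_tree_state_bound:
  "measure_pmf.prob (mini_tree (Suc t))
      {T. inner_edges S (edges T) = p \<and> inner_edges (- S) (edges T) = q}
    \<le> state_bound (card (S \<inter> {1..Suc t})) (card ({1..Suc t} - S)) p q"
proof (induction t arbitrary: S p q)
  case 0
  show ?case
  proof (cases "1 \<in> S")
    case True
    then have c: "card (S \<inter> {1..Suc 0}) = 1" "card ({1..Suc 0} - S) = 0" by auto
    have 1: "state_bound 1 0 1 0 = 1" by (simp add: state_bound_def side_ratio_def)
    show ?thesis unfolding c using True 1 state_bound_nonneg[of 1 0 p q]
      by (cases "p = 1 \<and> q = 0") (auto simp: initial_loop_def inner_edges_Cons indicator_def)
  next
    case False
    then have "S \<inter> {1..Suc 0} = {}" "{1..Suc 0} - S = {1}" by auto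
    then have c: "card (S \<inter> {1..Suc 0}) = 0" "card ({1..Suc 0} - S) = 1" by (simp_all only: card.empty card_1_singleton_iff) auto
    have 1: "state_bound 0 1 0 1 = 1" by (simp add: state_bound_def side_ratio_def)
    show ?thesis unfolding c using False 1 state_bound_nonneg[of 0 1 p q]
      by (cases "p = 0 \<and> q = 1") (auto simp: initial_loop_def inner_edges_Cons indicator_def)
  qed
next
  case (Suc t)
  have "{1..Suc (Suc t)} = insert (Suc (Suc t)) {1..Suc t}" by auto
  moreover have "measure_pmf.prob (mini_tree (Suc (Suc t)))
      {T. inner_edges S (edges T) = p \<and> inner_edges (- S) (edges T) = q}
    \<le> state_bound (card (S \<inter> insert (Suc (Suc t)) {1..Suc t})) (card (insert (Suc (Suc t)) {1..Suc t} - S)) p q"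
    unfolding mini_tree.simps
    by (rule attachment_step[OF Suc.IH])
       (auto simp: edges_add_mini_vertex prob_endpoint[OF mini_graph_mini_tree])
  ultimately show ?case by simp
qed

lemma mini_tree'_state_bound:
  "measure_pmf.prob (mini_tree' (Suc t))
      {T. inner_edges S (tl (edges T)) = p \<and> inner_edges (- S) (tl (edges T)) = q}
    \<le> state_bound (card (S \<inter> {2..Suc t})) (card ({2..Suc t} - S)) p q"
proof (induction t arbitrary: S p q)
  case 0
  show ?case
    using state_bound_nonneg[of 0 0 p q]
    by (auto simp: initial_loop_def state_bound_def[of 0 0 0 0] side_ratio_def indicator_def)
next
  case (Suc t)
  have "{2..Suc (Suc t)} = insert (Suc (Suc t)) {2..Suc t}" by auto
  moreover have "measure_pmf.prob (mini_tree' (Suc (Suc t)))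
      {T. inner_edges S (tl (edges T)) = p \<and> inner_edges (- S) (tl (edges T)) = q}
    \<le> state_bound (card (S \<inter> insert (Suc (Suc t)) {2..Suc t})) (card (insert (Suc (Suc t)) {2..Suc t} - S)) p q"
    unfolding mini_tree'.simps
  proof (rule attachment_step[OF Suc.IH])
    fix T i assume "T \<in> set_pmf (mini_tree' (Suc t))"
    then have "edges T \<noteq> []" by (auto dest!: mini_graph_mini_tree' simp: mini_graph_def)
    then show "tl (edges (add_mini_vertex (Suc t) T i)) = tl (edges T) @ [Upair (Suc (Suc t)) i]"
      by (simp add: edges_add_mini_vertex)
  next
    fix S T assume T: "T \<in> set_pmf (mini_tree' (Suc t))"
    show "measure_pmf.prob (endpoint' (Suc t) T) S
        \<le> (real (card {2..Suc t}) + 1 + real (inner_edges S (tl (edges T))) -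
            real (inner_edges (- S) (tl (edges T)))) / (2 * real (card {2..Suc t}) + 1)"
      using prob_endpoint'[OF mini_graph_mini_tree'[OF T], of S] by simp
  qed auto
  ultimately show ?case by simp
qed

text \<open>The number of cut edges is determined by \<open>P\<close> and \<open>Q\<close>, so that few cut edges means one of finitely
  many states.\<close>

lemma prob_cut_le:
  assumes bound: "\<And>p q. measure_pmf.prob M {T. P T = p \<and> Q T = q} \<le> state_bound a b p q"
    and total: "\<And>T. T \<in> set_pmf M \<Longrightarrow> X T + P T + Q T = a + b"
  shows "measure_pmf.prob M {T. real (X T) \<le> y}
    \<le> (\<Sum>(p, q) | p \<le> a \<and> q \<le> b \<and> real (a + b - p - q) \<le> y. state_bound a b p q)"
proof -
  define J where "J = {(p, q). p \<le> a + b \<and> q \<le> a + b \<and> real (a + b - p - q) \<le> y}"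
  have fin: "finite J" by (rule finite_subset[of _ "{..a + b} \<times> {..a + b}"]) (auto simp: J_def)
  have "measure_pmf.prob M {T. real (X T) \<le> y}
      \<le> measure_pmf.prob M (\<Union>(p, q)\<in>J. {T. P T = p \<and> Q T = q})"
  proof (intro measure_pmf.finite_measure_mono_AE)
    show "AE T in measure_pmf M. T \<in> {T. real (X T) \<le> y} \<longrightarrow> T \<in> (\<Union>(p, q)\<in>J. {T. P T = p \<and> Q T = q})"
      unfolding AE_measure_pmf_iff
    proof (intro ballI impI)
      fix T assume T: "T \<in> set_pmf M" "T \<in> {T. real (X T) \<le> y}"
      have "a + b - P T - Q T = X T" "P T \<le> a + b" "Q T \<le> a + b" using total[OF T(1)] by auto
      then show "T \<in> (\<Union>(p, q)\<in>J. {T. P T = p \<and> Q T = q})" using T(2) by (auto simp: J_def)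
    qed
  qed simp
  also have "\<dots> \<le> (\<Sum>(p, q)\<in>J. measure_pmf.prob M {T. P T = p \<and> Q T = q})"
    unfolding case_prod_unfold by (intro measure_UNION_le fin) auto
  also have "\<dots> \<le> (\<Sum>(p, q)\<in>J. state_bound a b p q)"
    using bound by (intro sum_mono) auto
  also have "\<dots> = (\<Sum>(p, q) | p \<le> a \<and> q \<le> b \<and> real (a + b - p - q) \<le> y. state_bound a b p q)"
    using fin by (intro sum.mono_neutral_right) (auto simp: J_def not_le intro: state_bound_eq_0)
  finally show ?thesis .
qed

section \<open>Passing to blocks\<close>

definition mini_vertices :: "nat \<Rightarrow> nat set \<Rightarrow> nat set" where
  "mini_vertices h S = {j. j \<ge> 1 \<and> block h j \<in> S}"

lemma bij_betw_mini_vertices: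
  assumes "h \<ge> 1" "S \<subseteq> {1..}"
  shows "bij_betw (\<lambda>(i, r). h * (i - 1) + r + 1) (S \<times> {..<h}) (mini_vertices h S)"
proof (rule bij_betwI[where g = "\<lambda>j. (block h j, (j - 1) mod h)"])
  have *: "block h (h * (i - 1) + r + 1) = i" if "i \<ge> 1" "r < h" for i r
    using that assms(1) by (simp add: block_def)
  show "(\<lambda>(i, r). h * (i - 1) + r + 1) \<in> S \<times> {..<h} \<rightarrow> mini_vertices h S"
    using * assms(2) by (auto simp: mini_vertices_def)
  show "(\<lambda>j. (block h j, (j - 1) mod h)) \<in> mini_vertices h S \<rightarrow> S \<times> {..<h}"
    using assms(1) by (auto simp: mini_vertices_def)
  show "(\<lambda>j. (block h j, (j - 1) mod h)) (case x of (i, r) \<Rightarrow> h * (i - 1) + r + 1) = x"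
    if "x \<in> S \<times> {..<h}" for x
    using that * assms(2) by auto
  show "(case (block h j, (j - 1) mod h) of (i, r) \<Rightarrow> h * (i - 1) + r + 1) = j"
    if "j \<in> mini_vertices h S" for j
    using that assms(1) by (auto simp: mini_vertices_def block_def)
qed

lemma card_mini_vertices:
  assumes "h \<ge> 1" "S \<subseteq> {1..}"
  shows "card (mini_vertices h S) = h * card S"
  using bij_betw_same_card[OF bij_betw_mini_vertices[OF assms]]
  by (simp add: card_cartesian_product mult.commute[of h])

lemma block_image:
  assumes "h \<ge> 1"
  shows "block h ` {1..h * n} = {1..n}"
proof
  show "block h ` {1..h * n} \<subseteq> {1..n}"
  proof clarify
    fix j assume "j \<in> {1..h * n}"
    then have "j - 1 < n * h" by (auto simp: mult.commute)
    then have "(j - 1) div h < n" by (simp add: less_mult_imp_div_less)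
    then show "block h j \<in> {1..n}" by (simp add: block_def)
  qed
  show "{1..n} \<subseteq> block h ` {1..h * n}"
  proof
    fix i assume i: "i \<in> {1..n}"
    have "block h (h * i) = i"
    proof -
      obtain i' where i': "i = Suc i'" using i by (cases i) auto
      have "(h * i - 1) div h = i'" using assms by (intro div_nat_eqI) (auto simp: i')
      then show ?thesis by (simp add: block_def i')
    qed
    moreover have "h * i \<in> {1..h * n}" using i assms by auto
    ultimately show "i \<in> block h ` {1..h * n}" by (metis image_eqI)
  qed
qed

lemma mini_vertices_subset:
  assumes "h \<ge> 1" "S \<subseteq> {1..n}"
  shows "mini_vertices h S \<subseteq> {1..h * n}"
proof
  fix j assume j: "j \<in> mini_vertices h S"
  then have "(j - 1) div h < n" using assms(2) by (auto simp: mini_vertices_def block_def)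
  then have "j - 1 < n * h" using assms(1) by (simp add: div_less_iff_less_mult)
  then show "j \<in> {1..h * n}" using j by (auto simp: mini_vertices_def mult.commute)
qed

lemma cut_size_merge_blocks:
  assumes "verts T = {1..t}" "\<forall>e\<in>set (edges T). set_uprod e \<subseteq> {1..t}"
  shows "cut_size (merge_blocks h T) S + inner_edges (mini_vertices h S) (edges T)
    + inner_edges (- mini_vertices h S) (edges T) = length (edges T)"
proof -
  define cut where "cut e \<longleftrightarrow> (\<exists>x\<in>S. \<exists>y\<in>block h ` {1..t} - S. map_uprod (block h) e = Upair x y)" for e
  define A where "A = mini_vertices h S"
  have cut: "cut e \<longleftrightarrow> \<not> set_uprod e \<subseteq> A \<and> \<not> set_uprod e \<subseteq> - A" if "set_uprod e \<subseteq> {1..t}" for e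
  proof (cases e)
    case (Upair i j)
    have "cut e \<longleftrightarrow> (block h i \<in> S \<and> block h j \<notin> S) \<or> (block h i \<notin> S \<and> block h j \<in> S)"
    proof
      assume "cut e"
      then obtain x y where "x \<in> S" "y \<notin> S" "Upair (block h i) (block h j) = Upair x y"
        by (auto simp: cut_def Upair)
      then show "(block h i \<in> S \<and> block h j \<notin> S) \<or> (block h i \<notin> S \<and> block h j \<in> S)"
        by auto
    next
      have ij: "block h i \<in> block h ` {1..t}" "block h j \<in> block h ` {1..t}"
        using that by (auto simp: Upair simp del: atLeastAtMost_iff)
      assume "(block h i \<in> S \<and> block h j \<notin> S) \<or> (block h i \<notin> S \<and> block h j \<in> S)"
      then show "cut e"
      proof
        assume "block h i \<in> S \<and> block h j \<notin> S"
        then show ?thesis unfolding cut_def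
          using ij by (intro bexI[of _ "block h i"] bexI[of _ "block h j"]) (auto simp: Upair)
      next
        assume "block h i \<notin> S \<and> block h j \<in> S"
        then show ?thesis unfolding cut_def
          using ij by (intro bexI[of _ "block h j"] bexI[of _ "block h i"]) (auto simp: Upair)
      qed
    qed
    then show ?thesis using that Upair by (auto simp: A_def mini_vertices_def)
  qed
  have "length (filter cut es) + inner_edges A es + inner_edges (- A) es = length es"
    if "\<forall>e\<in>set es. set_uprod e \<subseteq> {1..t}" for es
    using that
  proof (induction es)
    case (Cons e es)
    have "\<not> (set_uprod e \<subseteq> A \<and> set_uprod e \<subseteq> - A)" by (cases e) auto
    then show ?case using Cons cut[of e] by (auto simp: inner_edges_Cons)
  qed simp
  from this[OF assms(2)] show ?thesis
    by (simp add: cut_size_def merge_blocks_def assms(1) A_def filter_map comp_def cut_def[abs_def])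
qed

section \<open>Few cut edges at a fixed set\<close>

text \<open>In both models this over \<open>(h * n) choose (h * k)\<close> is, up to a correction factor in the second
  one, the bound for having at most \<open>y\<close> of $N = hn$ edges cut at a set of \<open>k\<close> vertices.\<close>

definition cut_tail :: "nat \<Rightarrow> real \<Rightarrow> real" where
  "cut_tail N y = 4 powr y * (exp 1 * real N / y) powr (2 * y)"

lemma prob_cut_size_pa_graph_le:
  assumes h: "h \<ge> 1" and S: "S \<subseteq> {1..n}" "card S \<ge> 1" and y: "0 < y" "y \<le> real (h * n)"
  shows "measure_pmf.prob (pa_graph h n) {g. real (cut_size g S) \<le> y}
    \<le> cut_tail (h * n) y / real ((h * n) choose (h * card S))"
proof -
  define S' where "S' = mini_vertices h S"
  have "n \<ge> 1" using S by (cases n) auto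
  then obtain t where t: "h * n = Suc t" using h by (cases "h * n") auto
  have sub: "S' \<subseteq> {1..Suc t}" using mini_vertices_subset[OF h S(1)] by (simp add: S'_def t)
  have card: "card S' = h * card S" unfolding S'_def using S h by (intro card_mini_vertices) auto
  have a: "card (S' \<inter> {1..Suc t}) = h * card S" using sub card by (simp add: Int_absorb2)
  have ab: "h * card S + card ({1..Suc t} - S') = h * n"
    using card_Diff_subset[of S' "{1..Suc t}"] card_mono[OF _ sub] finite_subset[OF sub] sub card t by auto
  have "measure_pmf.prob (pa_graph h n) {g. real (cut_size g S) \<le> y}
      = measure_pmf.prob (mini_tree (Suc t)) {T. real (cut_size (merge_blocks h T) S) \<le> y}"
    by (simp add: pa_graph_def t vimage_def)
  also have "\<dots> \<le> (\<Sum>(p, q) | p \<le> h * card S \<and> q \<le> card ({1..Suc t} - S')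
      \<and> real (h * card S + card ({1..Suc t} - S') - p - q) \<le> y. state_bound (h * card S) (card ({1..Suc t} - S')) p q)"
  proof (rule prob_cut_le)
    show "measure_pmf.prob (mini_tree (Suc t)) {T. inner_edges S' (edges T) = p \<and> inner_edges (- S') (edges T) = q}
        \<le> state_bound (h * card S) (card ({1..Suc t} - S')) p q" for p q
      using mini_tree_state_bound[of t S' p q] unfolding a .
  next
    fix T assume "T \<in> set_pmf (mini_tree (Suc t))"
    then have T: "mini_graph (Suc t) T" by (rule mini_graph_mini_tree)
    show "cut_size (merge_blocks h T) S + inner_edges S' (edges T) + inner_edges (- S') (edges T)
        = h * card S + card ({1..Suc t} - S')"
      using cut_size_merge_blocks[of T "Suc t" h S] T unfolding ab unfolding t S'_def
      by (simp add: mini_graph_def)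
  qed
  also have "\<dots> \<le> 4 powr y * (exp 1 * real (h * n) / y) powr (2 * y)
      / real ((h * card S + card ({1..Suc t} - S')) choose (h * card S))"
    by (intro sum_state_bound_le y) (simp only: ab)
  finally show ?thesis unfolding ab cut_tail_def .
qed

text \<open>Mini-vertex 1 is not counted here, so the binomial coefficient in the denominator is
  ${hn-1 \choose hk-1}$ or ${hn-1 \choose hk}$ according as 1 belongs to \<open>S\<close> or not. The factor \<open>n / card S\<close>
  for the sets that contain 1 is large for small sets.\<close>

lemma prob_cut_size_pa_graph'_le:
  assumes h: "h \<ge> 1" and S: "S \<subseteq> {1..n}" "card S \<ge> 1" "2 * card S \<le> n" and y: "0 < y" "y \<le> real (h * n)"
  shows "measure_pmf.prob (pa_graph' h n) {g. real (cut_size g S) \<le> y}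
    \<le> cut_tail (h * n) y * (if 1 \<in> S then real n / real (card S) else 2) / real ((h * n) choose (h * card S))"
proof -
  define S' where "S' = mini_vertices h S"
  define k where "k = card S"
  have k: "k \<ge> 1" "2 * k \<le> n" using S by (simp_all add: k_def)
  have n: "n \<ge> 1" using S by (cases n) auto
  then obtain t where t: "h * n = Suc t" using h by (cases "h * n") auto
  have sub: "S' \<subseteq> {1..Suc t}" using mini_vertices_subset[OF h S(1)] by (simp add: S'_def t)
  have card: "card S' = h * k" unfolding S'_def k_def using S h by (intro card_mini_vertices) auto
  have fin: "finite S'" using sub by (rule finite_subset) simp
  have in1: "1 \<in> S' \<longleftrightarrow> 1 \<in> S" by (simp add: S'_def mini_vertices_def block_def)
  define a where "a = card (S' \<inter> {2..Suc t})"
  define b where "b = card ({2..Suc t} - S')"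
  have ab: "a + b = t" unfolding a_def b_def
    by (metis Int_commute card_Int_Diff card_atLeastAtMost diff_Suc_Suc finite_atLeastAtMost
        numeral_2_eq_2 diff_Suc_1 minus_nat.diff_0)
  have "measure_pmf.prob (pa_graph' h n) {g. real (cut_size g S) \<le> y}
      = measure_pmf.prob (mini_tree' (Suc t)) {T. real (cut_size (merge_blocks h T) S) \<le> y}"
    by (simp add: pa_graph'_def t vimage_def)
  also have "\<dots> \<le> (\<Sum>(p, q) | p \<le> a \<and> q \<le> b \<and> real (a + b - p - q) \<le> y. state_bound a b p q)"
  proof (rule prob_cut_le)
    show "measure_pmf.prob (mini_tree' (Suc t))
          {T. inner_edges S' (tl (edges T)) = p \<and> inner_edges (- S') (tl (edges T)) = q}
        \<le> state_bound a b p q" for p q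
      using mini_tree'_state_bound[of t S' p q] unfolding a_def b_def .
  next
    fix T assume "T \<in> set_pmf (mini_tree' (Suc t))"
    then have T: "mini_graph (Suc t) T" by (rule mini_graph_mini_tree')
    then obtain es where es: "edges T = Upair 1 1 # es" by (cases "edges T") (auto simp: mini_graph_def)
    have "cut_size (merge_blocks h T) S + inner_edges S' (edges T) + inner_edges (- S') (edges T) = Suc t"
      using cut_size_merge_blocks[of T "Suc t" h S] T unfolding S'_def by (simp add: mini_graph_def)
    then show "cut_size (merge_blocks h T) S + inner_edges S' (tl (edges T)) + inner_edges (- S') (tl (edges T))
        = a + b"
      unfolding ab es by (auto simp: inner_edges_Cons split: if_splits)
  qed
  also have "\<dots> \<le> 4 powr y * (exp 1 * real (h * n) / y) powr (2 * y) / real ((a + b) choose a)"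
    by (intro sum_state_bound_le y) (simp add: ab t)
  also have "\<dots> = cut_tail (h * n) y * (1 / real (t choose a))"
    by (simp add: ab cut_tail_def)
  also have "\<dots> \<le> cut_tail (h * n) y * ((if 1 \<in> S then real n / real k else 2) / real ((h * n) choose (h * k)))"
  proof (intro mult_left_mono)
    show "1 / real (t choose a) \<le> (if 1 \<in> S then real n / real k else 2) / real ((h * n) choose (h * k))"
    proof (cases "1 \<in> S")
      case True
      then have "S' \<inter> {2..Suc t} = S' - {1}" using sub by auto
      then have a: "Suc a = h * k" using True in1 card fin h k by (simp add: a_def)
      have "h * k * ((h * n) choose (h * k)) = h * n * (t choose a)"
        using Suc_times_binomial[of a t] unfolding a t .
      then have "k * ((h * n) choose (h * k)) = n * (t choose a)" using h by simp
      then have e: "real k * real ((h * n) choose (h * k)) = real n * real (t choose a)"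
        by (metis of_nat_mult)
      have "a \<le> t" using ab by simp
      then have "real (t choose a) > 0" "real ((h * n) choose (h * k)) > 0"
        using k by auto
      then show ?thesis using True e k by (simp add: field_simps)
    next
      case False
      have "{2..Suc t} = {1..Suc t} - {1}" by auto
      then have "S' \<inter> {2..Suc t} = S'" using sub False in1 by blast
      then have a: "a = h * k" using card by (simp add: a_def)
      have t': "h * n - 1 = t" by (simp add: t)
      have "h * ((n - k) * ((h * n) choose (h * k))) = (h * n - h * k) * ((h * n) choose (h * k))"
        by (simp only: mult.assoc[symmetric] diff_mult_distrib2)
      also have "\<dots> = h * (n * (t choose a))"
        unfolding binomial_absorb_comp t' a by (rule mult.assoc)
      finally have "(n - k) * ((h * n) choose (h * k)) = n * (t choose a)" using h by simp
      moreover have "n * ((h * n) choose (h * k)) \<le> 2 * (n - k) * ((h * n) choose (h * k))"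
        using k by (intro mult_right_mono) auto
      ultimately have "n * ((h * n) choose (h * k)) \<le> 2 * (n * (t choose a))"
        by (simp only: mult.assoc)
      then have "(h * n) choose (h * k) \<le> 2 * (t choose a)" using n by simp
      then have "real ((h * n) choose (h * k)) \<le> 2 * real (t choose a)" by linarith
      moreover have "a \<le> t" using ab by simp
      ultimately show ?thesis using False k by (simp add: field_simps)
    qed
  qed (simp add: cut_tail_def)
  finally show ?thesis unfolding k_def times_divide_eq_right .
qed

section \<open>Summing over all sets of a given size\<close>

text \<open>A proportion of only $k/n$ of the sets of size \<open>k\<close> contains 1, which compensates for the weight
  $n/k$ of these sets.\<close>

lemma sum_weight_le:
  assumes "1 \<le> k" "k \<le> n"
  shows "(\<Sum>S | S \<subseteq> {1..n} \<and> card S = k. if 1 \<in> S then real n / real k else 2) \<le> 3 * real (n choose k)"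
proof -
  define F where "F = {S. S \<subseteq> {1..n} \<and> card S = k}"
  have fin: "finite F" unfolding F_def by (rule finite_subset[of _ "Pow {1..n}"]) auto
  have cF: "card F = n choose k" unfolding F_def using n_subsets[of "{1..n}" k] by simp
  have "{S \<in> F. 1 \<notin> S} = {S. S \<subseteq> {2..n} \<and> card S = k}"
  proof -
    have "S \<subseteq> {1..n} \<and> 1 \<notin> S \<longleftrightarrow> S \<subseteq> {2..n}" for S
    proof -
      have "{2..n} = {1..n} - {1}" by auto
      then show ?thesis by blast
    qed
    then show ?thesis unfolding F_def by blast
  qed
  then have c0: "card {S \<in> F. 1 \<notin> S} = (n - 1) choose k" using n_subsets[of "{2..n}" k] by simp
  have "card F = card {S \<in> F. 1 \<in> S} + card {S \<in> F. 1 \<notin> S}"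
    using fin by (subst card_Un_disjoint[symmetric]) (auto intro: arg_cong[where f = card])
  moreover have "n choose k = ((n - 1) choose (k - 1)) + ((n - 1) choose k)"
    using assms by (simp add: choose_reduce_nat)
  ultimately have c1: "card {S \<in> F. 1 \<in> S} = (n - 1) choose (k - 1)" using cF c0 by simp
  have e: "real k * real (n choose k) = real n * real ((n - 1) choose (k - 1))"
    using times_binomial_minus1_eq[of k n] assms by (metis of_nat_mult less_eq_Suc_le One_nat_def)
  have "(\<Sum>S\<in>F. if 1 \<in> S then real n / real k else 2)
      = (\<Sum>S\<in>{S \<in> F. 1 \<in> S}. real n / real k) + (\<Sum>S\<in>{S \<in> F. 1 \<notin> S}. 2)"
    using fin by (simp add: sum.If_cases Int_def Collect_conj_eq[symmetric] conj_commute Compl_eq)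
  also have "\<dots> = real n / real k * real ((n - 1) choose (k - 1)) + 2 * real ((n - 1) choose k)"
    unfolding sum_constant c0 c1 by simp
  also have "real n / real k * real ((n - 1) choose (k - 1)) = real (n choose k)"
    using e assms by (simp add: field_simps)
  also have "real ((n - 1) choose k) \<le> real (n choose k)"
    by (intro of_nat_mono binomial_right_mono) auto
  finally show ?thesis by (simp add: F_def)
qed

text \<open>Choosing \<open>k\<close> elements from each of \<open>h\<close> disjoint sets of size \<open>n\<close> chooses $hk$ elements from their union;
  formally, the product is one term of Vandermonde's identity.\<close>

lemma binomial_power_le: "(n choose k) ^ h \<le> (h * n) choose (h * k)"
proof (induction h)
  case (Suc h)
  have "(n choose k) ^ Suc h \<le> (n choose k) * ((h * n) choose (h * k))"
    using Suc by simp
  also have "\<dots> \<le> (\<Sum>i\<le>k + h * k. (n choose i) * ((h * n) choose (k + h * k - i)))"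
    by (intro member_le_sum[of k, THEN le_trans[rotated]]) auto
  also have "\<dots> = (Suc h * n) choose (Suc h * k)" unfolding vandermonde by simp
  finally show ?case .
qed simp

text \<open>This is better by a factor $2^k/(2k)$ than the familiar ${n \choose k} \ge (n/k)^k$. Since $1 - i/n \ge 1 - i/(2k)$,
  the quotient ${n \choose k}/n^k$ is smallest at $n = 2k$, where the lower bound $4^k/(2k)$
  for the central binomial coefficient applies.\<close>

lemma binomial_lower_bound:
  assumes "1 \<le> k" "2 * k \<le> n"
  shows "(2 * real n / real k) ^ k / (2 * real k) \<le> real (n choose k)"
proof -
  have "4 ^ k / (2 * real k) \<le> real ((2 * k) choose k)"
    using assms by (intro central_binomial_lower_bound) auto
  then have "(real n / (2 * real k)) ^ k * (4 ^ k / (2 * real k)) \<le> (real n / (2 * real k)) ^ k * real ((2 * k) choose k)"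
    by (intro mult_left_mono) auto
  also have "\<dots> = (\<Prod>i = 0..<k. real n / (2 * real k) * (real (2 * k - i) / real (k - i)))"
    unfolding prod.distrib by (simp add: binomial_altdef_of_nat)
  also have "\<dots> \<le> (\<Prod>i = 0..<k. real (n - i) / real (k - i))"
  proof (intro prod_mono conjI)
    fix i assume i: "i \<in> {0..<k}"
    have "real n * real (2 * k - i) \<le> real (n - i) * (2 * real k)"
    proof -
      have "real i * (2 * real k) \<le> real i * real n" using assms by (intro mult_left_mono) auto
      then show ?thesis using i assms by (simp add: of_nat_diff algebra_simps)
    qed
    then have "real n / (2 * real k) * real (2 * k - i) \<le> real (n - i)"
      using assms by (simp add: field_simps)
    then have "real n / (2 * real k) * real (2 * k - i) / real (k - i) \<le> real (n - i) / real (k - i)"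
      by (rule divide_right_mono) simp
    then show "real n / (2 * real k) * (real (2 * k - i) / real (k - i)) \<le> real (n - i) / real (k - i)" by simp
  qed auto
  also have "\<dots> = real (n choose k)" using assms by (simp add: binomial_altdef_of_nat)
  also have "(real n / (2 * real k)) ^ k * (4 ^ k / (2 * real k)) = (2 * real n / real k) ^ k / (2 * real k)"
    using power_mult_distrib[of "2 :: real" 2 k] by (simp add: power_divide power_mult_distrib)
  finally show ?thesis .
qed

text \<open>The factor $2^{(h-1)k}$ gained from \<open>binomial_lower_bound\<close> absorbs $4^y \le 2^{(h-1)k}$.\<close>

lemma cut_tail_ratio_le:
  fixes x :: real
  assumes h: "h \<ge> 1" and k: "1 \<le> k" "2 * k \<le> n" and x: "0 < x" "2 * real h * x \<le> real h - 1"
  shows "cut_tail (h * n) (real h * x * real k) * real (n choose k) / real ((h * n) choose (h * k))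
    \<le> (2 * real k) ^ (h - 1)
      * ((exp 1 / x) powr (2 * real h * x) * (real k / real n) powr (real h - 1 - 2 * real h * x)) ^ k"
proof -
  define y where "y = real h * x * real k"
  define v where "v = real k / real n"
  define d where "d = h - 1"
  have d: "h = Suc d" "real h - 1 = real d" using h by (simp_all add: d_def)
  have v: "v > 0" using k by (simp add: v_def)
  have n: "n > 0" using k by simp
  have pos: "real (n choose k) > 0" using k by simp
  have "real (n choose k) / real ((h * n) choose (h * k)) \<le> real (n choose k) / real (n choose k) ^ h"
    using binomial_power_le[of n k h] pos k
    by (intro divide_left_mono mult_pos_pos) (auto simp flip: of_nat_power)
  also have "\<dots> = 1 / real (n choose k) ^ d" using pos by (simp add: d(1))
  also have "\<dots> \<le> 1 / ((2 * real n / real k) ^ k / (2 * real k)) ^ d"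
    using binomial_lower_bound[OF k] k n pos
    by (intro divide_left_mono power_mono) (auto intro!: mult_pos_pos divide_pos_pos)
  also have "\<dots> = (2 * real k) ^ d * ((v / 2) ^ d) ^ k"
    using k n by (simp add: v_def power_divide field_simps flip: power_mult)
  finally have 1: "real (n choose k) / real ((h * n) choose (h * k)) \<le> (2 * real k) ^ d * ((v / 2) ^ d) ^ k" .
  have "4 powr y = 2 powr (2 * y)" by (simp flip: powr_powr)
  also have "\<dots> \<le> 2 powr (real d * real k)"
    using mult_right_mono[OF x(2), of "real k"] unfolding d(2)
    by (intro powr_mono) (auto simp: y_def algebra_simps)
  also have "\<dots> = (2 ^ d) ^ k" by (simp add: powr_realpow flip: of_nat_mult power_mult)
  finally have 2: "4 powr y \<le> (2 ^ d) ^ k" .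
  have "exp 1 * real (h * n) / y = exp 1 / x / v"
    using h k n x by (simp add: y_def v_def field_simps)
  then have "(exp 1 * real (h * n) / y) powr (2 * y) = (exp 1 / x / v) powr (2 * real h * x * real k)"
    by (simp add: y_def mult_ac)
  also have "\<dots> = ((exp 1 / x / v) powr (2 * real h * x)) ^ k"
    using x v by (simp add: powr_powr[symmetric] powr_realpow)
  also have "(exp 1 / x / v) powr (2 * real h * x) = (exp 1 / x) powr (2 * real h * x) * v powr (- (2 * real h * x))"
    using x v by (simp add: powr_divide powr_mult powr_minus_divide)
  finally have 3: "(exp 1 * real (h * n) / y) powr (2 * y)
      = ((exp 1 / x) powr (2 * real h * x) * v powr (- (2 * real h * x))) ^ k" .
  have "cut_tail (h * n) y * real (n choose k) / real ((h * n) choose (h * k))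
      = 4 powr y * (exp 1 * real (h * n) / y) powr (2 * y) * (real (n choose k) / real ((h * n) choose (h * k)))"
    by (simp add: cut_tail_def)
  also have "\<dots> \<le> (2 ^ d) ^ k * ((exp 1 / x) powr (2 * real h * x) * v powr (- (2 * real h * x))) ^ k
      * ((2 * real k) ^ d * ((v / 2) ^ d) ^ k)"
    unfolding 3 using 1 2 v by (intro mult_mono) (auto intro!: mult_nonneg_nonneg)
  also have "\<dots> = (2 * real k) ^ d * ((exp 1 / x) powr (2 * real h * x) * (v powr (- (2 * real h * x)) * v ^ d)) ^ k"
    by (simp add: power_mult_distrib power_divide mult_ac)
  also have "v powr (- (2 * real h * x)) * v ^ d = v powr (real h - 1 - 2 * real h * x)"
    using v unfolding d(2) by (simp add: powr_realpow[symmetric] powr_add[symmetric])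
  finally show ?thesis by (simp add: y_def v_def d_def)
qed

section \<open>Asymptotics of the union bound\<close>

lemma poly_times_geometric_bounded:
  fixes r :: real
  assumes "0 < r" "r < 1"
  shows "\<exists>L>0. \<forall>k. (2 * real k) ^ d * r ^ k \<le> L"
proof -
  have "(\<lambda>k. (2 * real k) ^ d * r ^ k) \<longlonglongrightarrow> 0"
    using assms by real_asymp
  then have "Bseq (\<lambda>k. (2 * real k) ^ d * r ^ k)" by (intro convergent_imp_Bseq convergentI)
  then obtain L where "L > 0" "\<And>k. norm ((2 * real k) ^ d * r ^ k) \<le> L" by (auto elim: BseqE)
  then show ?thesis by (intro exI[of _ L]) (auto simp: abs_le_iff)
qed

text \<open>For $k \le \sqrt n$ the base $C(k/n)^\delta$ is at most $C n^{-\delta/2}$, which is one small factor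
  with a geometric remainder. For $k > \sqrt n$ the base is at most $C u^\delta < 1$, and half of the
  exponent already gives a quantity exponentially small in $\sqrt n$. The geometric decay left over
  in both cases also absorbs the polynomial factor.\<close>

lemma union_bound_sum_small:
  fixes C \<delta> u :: real
  assumes C: "C > 0" and \<delta>: "\<delta> > 0" and u: "u > 0" and less: "C * u powr \<delta> < 1"
  shows "(\<lambda>n. \<Sum>k | 1 \<le> k \<and> real k \<le> u * real n. (2 * real k) ^ d * (C * (real k / real n) powr \<delta>) ^ k)
    \<in> o(\<lambda>n. real n powr - (\<delta> / 4))"
proof -
  \<comment> \<open>Two factors of \<open>s\<close> are at least the largest base; the value 1/2 dominates the bases for small \<open>k\<close>.\<close>
  define s where "s = max (1/2) (sqrt (C * u powr \<delta>))"
  have s: "0 < s" "s < 1" using less C u by (auto simp: s_def)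
  have "sqrt (C * u powr \<delta>) \<le> s" by (simp add: s_def)
  then have "(sqrt (C * u powr \<delta>))\<^sup>2 \<le> s\<^sup>2" using C by (intro power_mono) auto
  then have su: "C * u powr \<delta> \<le> s * s" using C by (simp add: power2_eq_square)
  have s2: "1/2 \<le> s" by (simp add: s_def)
  \<comment> \<open>One factor of \<open>r\<close> per unit of \<open>k\<close> pays for the polynomial, the other one keeps the sum finite.\<close>
  define r where "r = sqrt s"
  have r: "0 < r" "r < 1" "r * r = s" using s by (auto simp: r_def)
  obtain L where L: "L > 0" "\<And>k. (2 * real k) ^ d * r ^ k \<le> L"
    using poly_times_geometric_bounded[of r d] r by auto
  define w where "w n = C * real n powr - (\<delta> / 2)" for n
  define R where "R = L / (s * (1 - r))"
  define B where "B n = R * (w n + s powr sqrt (real n))" for n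
  have w_pos: "w n \<ge> 0" for n using C by (simp add: w_def)
  have bound: "(\<Sum>k | 1 \<le> k \<and> real k \<le> u * real n. (2 * real k) ^ d * (C * (real k / real n) powr \<delta>) ^ k) \<le> B n"
    if n: "n \<ge> 1" and wn: "w n \<le> 1 / 2" for n
  proof -
    define K where "K = {k. 1 \<le> k \<and> real k \<le> u * real n}"
    have fin: "finite K"
      by (rule finite_subset[of _ "{..nat \<lfloor>u * real n\<rfloor>}"]) (auto simp: K_def le_nat_floor)
    have "(\<Sum>k\<in>K. (2 * real k) ^ d * (C * (real k / real n) powr \<delta>) ^ k)
        \<le> (\<Sum>k\<in>K. L / s * (w n + s powr sqrt (real n)) * r ^ k)"
    proof (intro sum_mono)
      fix k assume k: "k \<in> K"
      have k1: "1 \<le> k" "real k \<le> u * real n" using k by (auto simp: K_def)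
      have ek: "s ^ k = s * s ^ (k - 1)" using k1 by (cases k) auto
      have "(C * (real k / real n) powr \<delta>) ^ k \<le> (w n + s powr sqrt (real n)) * s ^ (k - 1)"
      proof (cases "real k \<le> sqrt (real n)")
        case True
        have "real k / real n \<le> sqrt (real n) / real n" using True by (intro divide_right_mono) auto
        also have "\<dots> = real n powr - (1/2)"
          by (simp add: sqrt_divide_self_eq powr_minus powr_half_sqrt)
        finally have "(real k / real n) powr \<delta> \<le> (real n powr - (1/2)) powr \<delta>"
          using \<delta> by (intro powr_mono2) auto
        then have "C * (real k / real n) powr \<delta> \<le> w n"
          using C by (simp add: w_def powr_powr)
        then have "(C * (real k / real n) powr \<delta>) ^ k \<le> w n ^ k"
          using C by (intro power_mono) auto
        also have "\<dots> = w n * w n ^ (k - 1)" using k1 by (cases k) auto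
        also have "\<dots> \<le> w n * s ^ (k - 1)"
          using wn s2 w_pos by (intro mult_left_mono power_mono) auto
        also have "\<dots> \<le> (w n + s powr sqrt (real n)) * s ^ (k - 1)"
          using s by (intro mult_right_mono) auto
        finally show ?thesis .
      next
        case False
        have "(real k / real n) powr \<delta> \<le> u powr \<delta>"
          using k1 n \<delta> by (intro powr_mono2) (auto simp: field_simps)
        then have "C * (real k / real n) powr \<delta> \<le> s * s" using C su by (meson mult_left_mono less_imp_le order_trans)
        then have "(C * (real k / real n) powr \<delta>) ^ k \<le> (s * s) ^ k" using C by (intro power_mono) auto
        also have "\<dots> = s powr real k * s ^ k" using s by (simp add: power_mult_distrib powr_realpow)
        also have "\<dots> \<le> s powr sqrt (real n) * s ^ (k - 1)"
          using False s by (intro mult_mono powr_mono' power_decreasing) auto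
        also have "\<dots> \<le> (w n + s powr sqrt (real n)) * s ^ (k - 1)"
          using s w_pos by (intro mult_right_mono) auto
        finally show ?thesis .
      qed
      then have "(2 * real k) ^ d * (C * (real k / real n) powr \<delta>) ^ k
          \<le> (2 * real k) ^ d * ((w n + s powr sqrt (real n)) * s ^ (k - 1))"
        by (intro mult_left_mono) auto
      also have "\<dots> = ((2 * real k) ^ d * r ^ k) * (1 / s * (w n + s powr sqrt (real n)) * r ^ k)"
      proof -
        have "s ^ (k - 1) = r ^ k * r ^ k / s" using ek s r(3) by (simp flip: power_mult_distrib)
        then show ?thesis by simp
      qed
      also have "\<dots> \<le> L * (1 / s * (w n + s powr sqrt (real n)) * r ^ k)"
        using L(2)[of k] s r w_pos by (intro mult_right_mono) auto
      finally show "(2 * real k) ^ d * (C * (real k / real n) powr \<delta>) ^ k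
          \<le> L / s * (w n + s powr sqrt (real n)) * r ^ k" by simp
    qed
    also have "\<dots> = L / s * (w n + s powr sqrt (real n)) * (\<Sum>k\<in>K. r ^ k)"
      by (simp add: sum_distrib_left)
    also have "\<dots> \<le> L / s * (w n + s powr sqrt (real n)) * (1 / (1 - r))"
    proof (intro mult_left_mono)
      have "(\<Sum>k\<in>K. r ^ k) \<le> (\<Sum>k. r ^ k)"
        using r fin by (intro sum_le_suminf summable_geometric) auto
      then show "(\<Sum>k\<in>K. r ^ k) \<le> 1 / (1 - r)" using r by (simp add: suminf_geometric)
    qed (use L s w_pos in auto)
    also have "\<dots> = B n" by (simp add: B_def R_def)
    finally show ?thesis by (simp add: K_def)
  qed
  have "w \<longlonglongrightarrow> 0" unfolding w_def using \<delta> by real_asymp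
  then have "eventually (\<lambda>n. w n < 1 / 2) sequentially" by (rule order_tendstoD) simp
  then have ev: "eventually (\<lambda>n. w n \<le> 1 / 2 \<and> n \<ge> 1) sequentially"
    using eventually_ge_at_top[of 1] by eventually_elim simp
  have "(\<lambda>n. \<Sum>k | 1 \<le> k \<and> real k \<le> u * real n. (2 * real k) ^ d * (C * (real k / real n) powr \<delta>) ^ k) \<in> O(B)"
  proof (intro landau_o.big_mono eventually_mono[OF ev])
    fix n assume n: "w n \<le> 1 / 2 \<and> n \<ge> 1"
    have "0 \<le> (\<Sum>k | 1 \<le> k \<and> real k \<le> u * real n. (2 * real k) ^ d * (C * (real k / real n) powr \<delta>) ^ k)"
      using C by (intro sum_nonneg) auto
    then show "norm (\<Sum>k | 1 \<le> k \<and> real k \<le> u * real n. (2 * real k) ^ d * (C * (real k / real n) powr \<delta>) ^ k) \<le> norm (B n)"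
      using bound[of n] n by simp
  qed
  also have "B \<in> o(\<lambda>n. real n powr - (\<delta> / 4))"
  proof -
    have "w \<in> o(\<lambda>n. real n powr - (\<delta> / 4))"
      unfolding w_def using \<delta> C by real_asymp
    moreover have "(\<lambda>n. s powr sqrt (real n)) \<in> o(\<lambda>n. real n powr - (\<delta> / 4))"
      using s by real_asymp
    moreover have "R \<noteq> 0" using L s r by (simp add: R_def)
    ultimately show ?thesis
      unfolding B_def[abs_def] by (intro landau_o.small.cmult_in_iff[THEN iffD2] sum_in_smallo)
  qed
  finally show ?thesis .
qed

section \<open>Edge expansion\<close>

text \<open>The logarithm $z(1 - \ln u - \ln z)$ has derivative $-\ln u - \ln z \ge 0$ for $u, z \le 1$;
  the proof uses $\ln w \le w - 1$ in place of the derivative.\<close>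

lemma powr_scale_mono:
  fixes u :: real
  assumes u: "0 < u" "u \<le> 1" and x: "0 < x'" "x' \<le> x" "x \<le> 1"
  shows "(exp 1 / (u * x')) powr x' \<le> (exp 1 / (u * x)) powr x"
proof -
  have l: "ln (exp 1 / (u * z)) = 1 - ln u - ln z" if "z > 0" for z
    using that u by (simp add: ln_div ln_mult)
  have "x' * (ln x - ln x') = x' * ln (x / x')" using x by (simp add: ln_div)
  also have "\<dots> \<le> x' * (x / x' - 1)" using x by (intro mult_left_mono ln_le_minus_one) auto
  also have "\<dots> = x - x'" using x by (simp add: field_simps)
  finally have 1: "x' * (ln x - ln x') \<le> x - x'" .
  have "(x - x') * (ln x + ln u) \<le> 0"
    using x u by (intro mult_nonneg_nonpos add_nonpos_nonpos) auto
  then have "x' * (1 - ln u - ln x') \<le> x * (1 - ln u - ln x)"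
    using 1 by (simp add: algebra_simps)
  then have "exp (x' * ln (exp 1 / (u * x'))) \<le> exp (x * ln (exp 1 / (u * x)))"
    using l[of x] l[of x'] x by simp
  then show ?thesis using u x by (simp add: powr_def)
qed

lemma edge_expansion_less_imp:
  assumes V: "verts g = {1..n}" and u: "0 < u" and less: "edge_expansion u g < ereal \<alpha>"
  shows "\<exists>S. S \<subseteq> {1..n} \<and> 1 \<le> card S \<and> real (card S) \<le> u * real n \<and> real (cut_size g S) < \<alpha> * real (card S)"
proof -
  define F where "F = {S. S \<subseteq> {1..n} \<and> 1 \<le> card S \<and> real (card S) \<le> u * real n}"
  have n: "u * real n \<ge> 1" using less V by (auto simp: edge_expansion_def split: if_splits)
  then have "n \<noteq> 0" by (cases "n = 0") simp_all
  then have "{1} \<in> F" using n by (auto simp: F_def)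
  moreover have "finite F" unfolding F_def by (rule finite_subset[of _ "Pow {1..n}"]) auto
  moreover have "(MIN S\<in>F. ereal (real (cut_size g S) / real (card S))) < ereal \<alpha>"
    using less n by (simp add: edge_expansion_def V F_def)
  ultimately obtain S where S: "S \<in> F" "ereal (real (cut_size g S) / real (card S)) < ereal \<alpha>"
    by (subst (asm) Min_less_iff) auto
  then have "real (card S) > 0" by (auto simp: F_def)
  then have "real (cut_size g S) < \<alpha> * real (card S)" using S(2) by (simp add: field_simps)
  then show ?thesis using S(1) by (auto simp: F_def)
qed

lemma verts_pa_graph:
  assumes "h \<ge> 1" "n \<ge> 1"
  shows "g \<in> set_pmf (pa_graph h n) \<Longrightarrow> verts g = {1..n}"
    and "g \<in> set_pmf (pa_graph' h n) \<Longrightarrow> verts g = {1..n}"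
proof -
  obtain t where t: "h * n = Suc t" using assms by (cases "h * n") auto
  show "verts g = {1..n}" if g: "g \<in> set_pmf (pa_graph h n)"
  proof -
    obtain T where T: "T \<in> set_pmf (mini_tree (Suc t))" "g = merge_blocks h T"
      using g by (auto simp: pa_graph_def t)
    then show ?thesis
      using mini_graph_mini_tree[OF T(1)] block_image[OF assms(1), of n]
      by (simp add: merge_blocks_def mini_graph_def t)
  qed
  show "verts g = {1..n}" if g: "g \<in> set_pmf (pa_graph' h n)"
  proof -
    obtain T where T: "T \<in> set_pmf (mini_tree' (Suc t))" "g = merge_blocks h T"
      using g by (auto simp: pa_graph'_def t)
    then show ?thesis
      using mini_graph_mini_tree'[OF T(1)] block_image[OF assms(1), of n]
      by (simp add: merge_blocks_def mini_graph_def t)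
  qed
qed

text \<open>The union bound over all sets \<open>S\<close> of at most $un$ vertices, grouped by their size \<open>k\<close>: a violation of
  the expansion at \<open>S\<close> forces at most $hxk$ cut edges there.\<close>

lemma prob_small_expansion_le:
  fixes u x \<alpha> :: real
  assumes h: "h \<ge> 1" and u: "0 < u" "u \<le> 1 / 2" and x: "0 < x" "x \<le> 1" "2 * real h * x \<le> real h - 1"
    and \<alpha>: "\<alpha> \<le> real h * x" and G: "G = pa_graph h \<or> G = pa_graph' h" and n: "n \<ge> 1"
  shows "1 - measure_pmf.prob (G n) {g. edge_expansion u g \<ge> ereal \<alpha>}
    \<le> 3 * (\<Sum>k | 1 \<le> k \<and> real k \<le> u * real n. (2 * real k) ^ (h - 1)
      * ((exp 1 / x) powr (2 * real h * x) * (real k / real n) powr (real h - 1 - 2 * real h * x)) ^ k)"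
proof -
  define F where "F = {S. S \<subseteq> {1..n} \<and> 1 \<le> card S \<and> real (card S) \<le> u * real n}"
  define K where "K = {k. 1 \<le> k \<and> real k \<le> u * real n}"
  define w where "w S = (if 1 \<in> S then real n / real (card S) else 2)" for S :: "nat set"
  define y where "y k = real h * x * real k" for k
  define c where "c k = cut_tail (h * n) (y k) / real ((h * n) choose (h * k))" for k
  have half: "2 * k \<le> n" if "real k \<le> u * real n" for k
  proof -
    have "u * real n \<le> 1 / 2 * real n" using u by (intro mult_right_mono) auto
    then show ?thesis using that by linarith
  qed
  have finF: "finite F" unfolding F_def by (rule finite_subset[of _ "Pow {1..n}"]) auto
  have finK: "finite K" by (rule finite_subset[of _ "{..n}"]) (auto simp: K_def dest: half)
  have c_nonneg: "c k \<ge> 0" for k by (simp add: c_def cut_tail_def)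
  have each: "measure_pmf.prob (G n) {g. real (cut_size g S) \<le> y (card S)} \<le> c (card S) * w S"
    if "S \<in> F" for S
  proof -
    have S: "S \<subseteq> {1..n}" "card S \<ge> 1" "2 * card S \<le> n" using that half by (auto simp: F_def)
    have "x * real (card S) \<le> 1 * real n" using x S by (intro mult_mono) auto
    then have "real h * (x * real (card S)) \<le> real h * real n" by (intro mult_left_mono) auto
    then have y: "0 < y (card S)" "y (card S) \<le> real (h * n)" using h x S by (auto simp: y_def)
    have "1 \<le> w S" using S n by (auto simp: w_def)
    then have "c (card S) * 1 \<le> c (card S) * w S" by (intro mult_left_mono c_nonneg)
    then show ?thesis
      using G prob_cut_size_pa_graph_le[OF h S(1,2) y] prob_cut_size_pa_graph'_le[OF h S y]
      by (auto simp: c_def w_def)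
  qed
  have "1 - measure_pmf.prob (G n) {g. edge_expansion u g \<ge> ereal \<alpha>}
      = measure_pmf.prob (G n) (- {g. edge_expansion u g \<ge> ereal \<alpha>})"
    using measure_pmf.prob_compl[of "{g. edge_expansion u g \<ge> ereal \<alpha>}" "G n"] by (simp add: Compl_eq_Diff_UNIV)
  also have "\<dots> \<le> measure_pmf.prob (G n) (\<Union>S\<in>F. {g. real (cut_size g S) \<le> y (card S)})"
  proof (intro measure_pmf.finite_measure_mono_AE)
    show "AE g in measure_pmf (G n). g \<in> - {g. edge_expansion u g \<ge> ereal \<alpha>}
        \<longrightarrow> g \<in> (\<Union>S\<in>F. {g. real (cut_size g S) \<le> y (card S)})"
      unfolding AE_measure_pmf_iff
    proof (intro ballI impI)
      fix g assume g: "g \<in> set_pmf (G n)" "g \<in> - {g. edge_expansion u g \<ge> ereal \<alpha>}"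
      have "verts g = {1..n}" using G g(1) verts_pa_graph[OF h n] by auto
      then obtain S where S: "S \<in> F" "real (cut_size g S) < \<alpha> * real (card S)"
        using edge_expansion_less_imp[of g n u \<alpha>] u g(2) by (auto simp: F_def not_le)
      have "\<alpha> * real (card S) \<le> y (card S)" unfolding y_def using \<alpha> by (intro mult_right_mono) auto
      then show "g \<in> (\<Union>S\<in>F. {g. real (cut_size g S) \<le> y (card S)})" using S by fastforce
    qed
  qed simp
  also have "\<dots> \<le> (\<Sum>S\<in>F. measure_pmf.prob (G n) {g. real (cut_size g S) \<le> y (card S)})"
    by (intro measure_UNION_le finF) auto
  also have "\<dots> \<le> (\<Sum>S\<in>F. c (card S) * w S)" by (intro sum_mono each)
  also have "\<dots> = (\<Sum>k\<in>K. \<Sum>S | S \<in> F \<and> card S = k. c (card S) * w S)"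
    by (intro sum.group[symmetric] finF finK) (auto simp: F_def K_def)
  also have "\<dots> \<le> (\<Sum>k\<in>K. c k * (3 * real (n choose k)))"
  proof (intro sum_mono)
    fix k assume k: "k \<in> K"
    then have k': "1 \<le> k" "k \<le> n" using half by (force simp: K_def)+
    have "{S. S \<in> F \<and> card S = k} = {S. S \<subseteq> {1..n} \<and> card S = k}"
      using k by (auto simp: F_def K_def)
    then have "(\<Sum>S | S \<in> F \<and> card S = k. c (card S) * w S)
        = (\<Sum>S | S \<subseteq> {1..n} \<and> card S = k. c k * (if 1 \<in> S then real n / real k else 2))"
      by (intro sum.cong) (auto simp: w_def)
    also have "\<dots> = c k * (\<Sum>S | S \<subseteq> {1..n} \<and> card S = k. if 1 \<in> S then real n / real k else 2)"
      by (simp add: sum_distrib_left)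
    also have "\<dots> \<le> c k * (3 * real (n choose k))"
      by (intro mult_left_mono sum_weight_le k' c_nonneg)
    finally show "(\<Sum>S | S \<in> F \<and> card S = k. c (card S) * w S) \<le> c k * (3 * real (n choose k))" .
  qed
  also have "\<dots> = 3 * (\<Sum>k\<in>K. cut_tail (h * n) (y k) * real (n choose k) / real ((h * n) choose (h * k)))"
    by (simp add: c_def sum_distrib_left mult_ac)
  also have "\<dots> \<le> 3 * (\<Sum>k\<in>K. (2 * real k) ^ (h - 1)
      * ((exp 1 / x) powr (2 * real h * x) * (real k / real n) powr (real h - 1 - 2 * real h * x)) ^ k)"
    unfolding y_def
    by (intro mult_left_mono sum_mono cut_tail_ratio_le h x) (auto simp: K_def dest: half)
  finally show ?thesis by (simp add: K_def)
qed

theorem theorem1p4: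
  fixes h :: nat and u x \<alpha> :: real and G :: "nat \<Rightarrow> nat multigraph pmf"
  assumes "h \<ge> 2"
    and "0 < u" "u \<le> 1 / 2"
    and "0 < x" "x \<le> 1"
    and "(exp 1 / (u * x)) powr (2 * real h * x) < (1 / u) ^ (h - 1)"
    and "\<alpha> < min ((real h - 1) / 2) (real h * x)"
    and "G = pa_graph h \<or> G = pa_graph' h"
  shows "\<exists>c>0. (\<lambda>n. 1 - measure_pmf.prob (G n) {g. edge_expansion u g \<ge> ereal \<alpha>})
                 \<in> o(\<lambda>n. real n powr (- c))"
proof -
  have h: "h \<ge> 1" "real h > 0" using assms(1) by auto
  \<comment> \<open>A smaller \<open>z\<close> in place of \<open>x\<close> makes $2hz < h - 1$ strict while still \<open>\<alpha> \<le> h * z\<close>.\<close>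
  have "max (\<alpha> / real h) 0 < min x ((real h - 1) / (2 * real h))"
    using assms h by (auto simp: field_simps)
  then obtain z where z: "max (\<alpha> / real h) 0 < z" "z < min x ((real h - 1) / (2 * real h))"
    using dense by blast
  have z': "0 < z" "z \<le> x" "z \<le> 1" "2 * real h * z < real h - 1" "\<alpha> \<le> real h * z"
    using z h assms(5) by (auto simp: field_simps)
  define C where "C = (exp 1 / z) powr (2 * real h * z)"
  define \<delta> where "\<delta> = real h - 1 - 2 * real h * z"
  have \<delta>: "\<delta> > 0" using z' by (simp add: \<delta>_def)
  have "(exp 1 / (u * z)) powr (2 * real h * z) = ((exp 1 / (u * z)) powr z) powr (2 * real h)"
    by (simp add: powr_powr mult_ac)
  also have "\<dots> \<le> ((exp 1 / (u * x)) powr x) powr (2 * real h)"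
    using assms z' by (intro powr_mono2 powr_scale_mono) auto
  also have "\<dots> = (exp 1 / (u * x)) powr (2 * real h * x)" by (simp add: powr_powr mult_ac)
  finally have less: "(exp 1 / (u * z)) powr (2 * real h * z) < (1 / u) ^ (h - 1)"
    using assms(6) by linarith
  have "C * u powr \<delta> = (exp 1 / (u * z)) powr (2 * real h * z) * u powr (real h - 1)"
    using assms(2) z' by (simp add: C_def \<delta>_def powr_diff powr_divide powr_mult)
  also have "\<dots> < (1 / u) ^ (h - 1) * u powr (real h - 1)"
    using less assms(2) by (intro mult_strict_right_mono) auto
  also have "\<dots> = (1 / u) ^ (h - 1) * u ^ (h - 1)"
    using assms(2) h powr_realpow[of u "h - 1"] by (simp add: of_nat_diff)
  also have "\<dots> = 1" using assms(2) by (simp flip: power_mult_distrib)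
  finally have "C * u powr \<delta> < 1" .
  define B where "B n = (\<Sum>k | 1 \<le> k \<and> real k \<le> u * real n. (2 * real k) ^ (h - 1)
      * (C * (real k / real n) powr \<delta>) ^ k)" for n
  have "(\<lambda>n. 1 - measure_pmf.prob (G n) {g. edge_expansion u g \<ge> ereal \<alpha>}) \<in> O(B)"
  proof (intro bigoI[of _ 3] eventually_mono[OF eventually_ge_at_top[of 1]])
    fix n :: nat assume n: "n \<ge> 1"
    have "1 - measure_pmf.prob (G n) {g. edge_expansion u g \<ge> ereal \<alpha>} \<le> 3 * B n"
      using prob_small_expansion_le[OF h(1) assms(2,3) z'(1,3) _ z'(5) assms(8) n] z'(4)
      by (simp add: B_def C_def \<delta>_def)
    then show "norm (1 - measure_pmf.prob (G n) {g. edge_expansion u g \<ge> ereal \<alpha>}) \<le> 3 * norm (B n)"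
      using measure_pmf.prob_le_1[of "G n" "{g. edge_expansion u g \<ge> ereal \<alpha>}"] by simp
  qed
  also have "B \<in> o(\<lambda>n. real n powr - (\<delta> / 4))"
    unfolding B_def[abs_def] using \<open>C * u powr \<delta> < 1\<close> \<delta> assms(2) z'
    by (intro union_bound_sum_small) (auto simp: C_def)
  finally show ?thesis using \<delta> by (intro exI[of _ "\<delta> / 4"]) auto
qed

end
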